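(* Let $(M,\Lambda)$ be a Poisson manifold and let $X:M\to TM$ be a vector field on $M$. Then $X$ is canonical, i.e. $\mathcal L_X\Lambda=0$, if and only if $X(M)$ is a Lagrangian submanifold of the Poisson manifold $(TM,d_T\Lambda)$.
   Context: Everything is smooth. A Poisson manifold $(M,\Lambda)$ is a manifold with a bivector field $\Lambda$ with vanishing Schouten bracket $[\Lambda,\Lambda]=0$. $\widetilde\Lambda^1:T^*M\to TM$ is $a\mapsto i_a\Lambda$. A submanifold $N$ of a Poisson manifold $(P,\Pi)$ is Lagrangian if for each $m\in N$ $$\widetilde\Pi^1\big((T_mN)^\circ\big)=\widetilde\Pi^1(T_m^*P)\cap T_mN,$$ where $(T_mN)^\circ\subset T_m^*P$ is the annihilator of $T_mN$. $d_T\Lambda$ is the tangent lift of $\Lambda$ to $TM$ (a Poisson structure on $TM$): in coordinates $(x^i,\dot x^j)$ on $TM$ induced by coordinates $(x^i)$ on $M$, if $\Lambda=\frac12\Lambda^{ij}\partial_{x^i}\wedge\partial_{x^j}$ with $\Lambda^{ij}=-\Lambda^{ji}$, then $$d_T\Lambda=\Lambda^{ij}\,\partial_{x^i}\wedge\partial_{\dot x^j}+\tfrac12\tfrac{\partial\Lambda^{ij}}{\partial x^k}\dot x^k\,\partial_{\dot x^i}\wedge\partial_{\dot x^j}.$$ *)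

theory Defs
  imports "HOL-Analysis.Analysis"
begin

section \<open>Smooth functions between Euclidean spaces\<close>

primrec Ck_on :: "nat \<Rightarrow> 'a::real_normed_vector set \<Rightarrow> ('a \<Rightarrow> 'b::real_normed_vector) \<Rightarrow> bool" where
  "Ck_on 0 S f \<longleftrightarrow> continuous_on S f"
| "Ck_on (Suc k) S f \<longleftrightarrow> (\<forall>x\<in>S. f differentiable (at x)) \<and>
     (\<forall>h. Ck_on k S (\<lambda>x. frechet_derivative f (at x) h))"

text \<open>Only used for open sets.\<close>
definition smooth_on :: "'a::real_normed_vector set \<Rightarrow> ('a \<Rightarrow> 'b::real_normed_vector) \<Rightarrow> bool" where
  "smooth_on S f \<longleftrightarrow> (\<forall>k. Ck_on k S f)"

section \<open>Smooth manifolds\<close>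

text \<open>
  A chart is a pair of its domain and its coordinate map (arbitrary outside the domain). A manifold
  is modelled on a Euclidean space \<open>'e\<close>, whose dimension is the dimension of the manifold and whose
  orthonormal basis \<open>Basis\<close> indexes the coordinates. The atlas need not be maximal; it determines
  the smooth structure.
\<close>

type_synonym ('a, 'e) chart = "'a set \<times> ('a \<Rightarrow> 'e)"

record ('a, 'e) manifold =
  mtop :: "'a topology"
  atlas :: "('a, 'e) chart set"

abbreviation points :: "('a, 'e) manifold \<Rightarrow> 'a set" where
  "points M \<equiv> topspace (mtop M)"

definition chart_inv :: "('a, 'e) chart \<Rightarrow> 'e \<Rightarrow> 'a" where
  "chart_inv c = inv_into (fst c) (snd c)"

definition transition :: "('a, 'e) chart \<Rightarrow> ('a, 'e) chart \<Rightarrow> 'e \<Rightarrow> 'e" where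
  "transition c d = snd d \<circ> chart_inv c"

definition chart_on :: "'a topology \<Rightarrow> ('a, 'e::euclidean_space) chart \<Rightarrow> bool" where
  "chart_on T c \<longleftrightarrow> openin T (fst c) \<and> open (snd c ` fst c) \<and>
     homeomorphic_map (subtopology T (fst c)) (top_of_set (snd c ` fst c)) (snd c)"

definition compatible :: "('a, 'e::euclidean_space) chart \<Rightarrow> ('a, 'e) chart \<Rightarrow> bool" where
  "compatible c d \<longleftrightarrow> smooth_on (snd c ` (fst c \<inter> fst d)) (transition c d) \<and>
     smooth_on (snd d ` (fst c \<inter> fst d)) (transition d c)"

definition smooth_manifold :: "('a, 'e::euclidean_space) manifold \<Rightarrow> bool" where
  "smooth_manifold M \<longleftrightarrow>
     Hausdorff_space (mtop M) \<and> second_countable (mtop M) \<and>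
     (\<forall>c\<in>atlas M. chart_on (mtop M) c) \<and>
     (\<forall>c\<in>atlas M. \<forall>d\<in>atlas M. compatible c d) \<and>
     (\<Union>c\<in>atlas M. fst c) = points M"

text \<open>A chart of the maximal atlas.\<close>
definition admissible_chart ::
    "('a, 'e::euclidean_space) manifold \<Rightarrow> ('a, 'e) chart \<Rightarrow> bool" where
  "admissible_chart M c \<longleftrightarrow> chart_on (mtop M) c \<and> (\<forall>d\<in>atlas M. compatible c d)"

definition smooth_map :: "('a, 'e::euclidean_space) manifold \<Rightarrow> ('b, 'f::euclidean_space) manifold \<Rightarrow>
    ('a \<Rightarrow> 'b) \<Rightarrow> bool" where
  "smooth_map M N f \<longleftrightarrow> continuous_map (mtop M) (mtop N) f \<and>
     (\<forall>c\<in>atlas M. \<forall>d\<in>atlas N.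
        smooth_on (snd c ` {p \<in> fst c. f p \<in> fst d}) (snd d \<circ> f \<circ> chart_inv c))"

definition euclidean_manifold :: "'e::euclidean_space set \<Rightarrow> ('e, 'e) manifold" where
  "euclidean_manifold S = \<lparr>mtop = top_of_set S, atlas = {(S, \<lambda>x. x)}\<rparr>"

section \<open>Tangent and cotangent vectors\<close>

text \<open>
  A tangent vector at \<open>p\<close> is the family of its coordinate vectors in all charts around \<open>p\<close>, related by
  the derivatives of the transition maps (and normalised to 0 at the charts not containing \<open>p\<close>).
\<close>

type_synonym ('a, 'e) tvec = "('a, 'e) chart \<Rightarrow> 'e"
type_synonym ('a, 'e) covec = "('a, 'e) tvec \<Rightarrow> real"
type_synonym ('a, 'e) bivec = "('a, 'e) covec \<Rightarrow> ('a, 'e) covec \<Rightarrow> real"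

definition charts_at :: "('a, 'e) manifold \<Rightarrow> 'a \<Rightarrow> ('a, 'e) chart set" where
  "charts_at M p = {c \<in> atlas M. p \<in> fst c}"

definition tangent_space :: "('a, 'e::euclidean_space) manifold \<Rightarrow> 'a \<Rightarrow> ('a, 'e) tvec set" where
  "tangent_space M p = {v.
     (\<forall>c. c \<notin> charts_at M p \<longrightarrow> v c = 0) \<and>
     (\<forall>c\<in>charts_at M p. \<forall>d\<in>charts_at M p.
        v d = frechet_derivative (transition c d) (at (snd c p)) (v c))}"

text \<open>Linear functionals on the tangent space (normalised to 0 outside of it).\<close>
definition cotangent_space :: "('a, 'e::euclidean_space) manifold \<Rightarrow> 'a \<Rightarrow> ('a, 'e) covec set" where
  "cotangent_space M p = {a.
     (\<forall>u\<in>tangent_space M p. \<forall>v\<in>tangent_space M p. a (\<lambda>c. u c + v c) = a u + a v) \<and>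
     (\<forall>r. \<forall>v\<in>tangent_space M p. a (\<lambda>c. r *\<^sub>R v c) = r * a v) \<and>
     (\<forall>v. v \<notin> tangent_space M p \<longrightarrow> a v = 0)}"

text \<open>The tangent vector at \<open>p\<close> whose coordinate vector in the chart \<open>c\<close> is \<open>x\<close>;
  for \<open>x = i \<in> Basis\<close> this is the coordinate vector \<open>\<partial>\<^bsub>x^i\<^esub>\<close>.\<close>
definition coord_vec :: "('a, 'e::euclidean_space) manifold \<Rightarrow> ('a, 'e) chart \<Rightarrow> 'a \<Rightarrow> 'e \<Rightarrow> ('a, 'e) tvec" where
  "coord_vec M c p x = (\<lambda>d. if d \<in> charts_at M p
     then frechet_derivative (transition c d) (at (snd c p)) x else 0)"

text \<open>The differential \<open>dx^i\<close> at \<open>p\<close> of a coordinate of the chart \<open>c\<close>, where \<open>i \<in> Basis\<close>.\<close>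
definition coord_covec :: "('a, 'e::euclidean_space) manifold \<Rightarrow> ('a, 'e) chart \<Rightarrow> 'a \<Rightarrow> 'e \<Rightarrow> ('a, 'e) covec" where
  "coord_covec M c p i = (\<lambda>v. if v \<in> tangent_space M p then v c \<bullet> i else 0)"

text \<open>The partial derivative at \<open>p\<close> of a function in the coordinate direction \<open>k \<in> Basis\<close> of the chart \<open>c\<close>.\<close>
definition partial :: "('a, 'e::euclidean_space) chart \<Rightarrow> 'e \<Rightarrow> ('a \<Rightarrow> real) \<Rightarrow> 'a \<Rightarrow> real" where
  "partial c k f p = frechet_derivative (f \<circ> chart_inv c) (at (snd c p)) k"

text \<open>
  The expressions below that are computed in this arbitrarily chosen chart around \<open>p\<close>
  have the same value in every chart of the atlas around \<open>p\<close>.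
\<close>
definition chart_at :: "('a, 'e) manifold \<Rightarrow> 'a \<Rightarrow> ('a, 'e) chart" where
  "chart_at M p = (SOME c. c \<in> charts_at M p)"

section \<open>The tangent bundle and vector fields\<close>

definition tangent_chart ::
    "('a, 'e::euclidean_space) manifold \<Rightarrow> ('a, 'e) chart \<Rightarrow> ('a \<times> ('a, 'e) tvec, 'e \<times> 'e) chart" where
  "tangent_chart M c = ({(p, v). p \<in> fst c \<and> v \<in> tangent_space M p}, \<lambda>(p, v). (snd c p, v c))"

definition tangent_bundle ::
    "('a, 'e::euclidean_space) manifold \<Rightarrow> ('a \<times> ('a, 'e) tvec, 'e \<times> 'e) manifold" where
  "tangent_bundle M =
     \<lparr>mtop = topology_generated_by
        {{w \<in> fst (tangent_chart M c). snd (tangent_chart M c) w \<in> S} | c S. c \<in> atlas M \<and> open S},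
      atlas = tangent_chart M ` atlas M\<rparr>"

definition vector_field ::
    "('a, 'e::euclidean_space) manifold \<Rightarrow> ('a \<Rightarrow> 'a \<times> ('a, 'e) tvec) \<Rightarrow> bool" where
  "vector_field M X \<longleftrightarrow> smooth_map M (tangent_bundle M) X \<and> (\<forall>p\<in>points M. fst (X p) = p)"

section \<open>Bivector fields\<close>

text \<open>A bivector at \<open>p\<close> is an alternating bilinear form on the cotangent space at \<open>p\<close>
  (its values on other arguments are irrelevant).\<close>
definition bivector_at :: "('a, 'e::euclidean_space) manifold \<Rightarrow> 'a \<Rightarrow> ('a, 'e) bivec \<Rightarrow> bool" where
  "bivector_at M p B \<longleftrightarrow>
     (\<forall>a\<in>cotangent_space M p. \<forall>b\<in>cotangent_space M p. B a b = - B b a) \<and>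
     (\<forall>a\<in>cotangent_space M p. \<forall>a'\<in>cotangent_space M p. \<forall>b\<in>cotangent_space M p.
        B (\<lambda>v. a v + a' v) b = B a b + B a' b) \<and>
     (\<forall>r. \<forall>a\<in>cotangent_space M p. \<forall>b\<in>cotangent_space M p. B (\<lambda>v. r * a v) b = r * B a b)"

text \<open>The bivector \<open>u \<and> v\<close>.\<close>
definition wedge :: "('a, 'e) tvec \<Rightarrow> ('a, 'e) tvec \<Rightarrow> ('a, 'e) bivec" where
  "wedge u v = (\<lambda>a b. a u * b v - a v * b u)"

text \<open>The coefficient \<open>\<Lambda>^{ij} = \<Lambda>(dx^i, dx^j)\<close> in \<open>\<Lambda> = 1/2 \<Lambda>^{ij} \<partial>\<^bsub>x^i\<^esub> \<and> \<partial>\<^bsub>x^j\<^esub>\<close>.\<close>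
definition bivec_coeff :: "('a, 'e::euclidean_space) manifold \<Rightarrow> ('a, 'e) chart \<Rightarrow> ('a \<Rightarrow> ('a, 'e) bivec) \<Rightarrow>
    'e \<Rightarrow> 'e \<Rightarrow> 'a \<Rightarrow> real" where
  "bivec_coeff M c \<Lambda> i j p = \<Lambda> p (coord_covec M c p i) (coord_covec M c p j)"

definition bivector_field ::
    "('a, 'e::euclidean_space) manifold \<Rightarrow> ('a \<Rightarrow> ('a, 'e) bivec) \<Rightarrow> bool" where
  "bivector_field M \<Lambda> \<longleftrightarrow> (\<forall>p\<in>points M. bivector_at M p (\<Lambda> p)) \<and>
     (\<forall>c\<in>atlas M. \<forall>i\<in>Basis. \<forall>j\<in>Basis.
        smooth_on (snd c ` fst c) (bivec_coeff M c \<Lambda> i j \<circ> chart_inv c))"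

text \<open>The map \<open>a \<mapsto> i\<^sub>a \<Theta>\<close> at \<open>p\<close>, with \<open>b (i\<^sub>a \<Theta>) = \<Theta>(a, b)\<close> for all covectors \<open>b\<close>.\<close>
definition sharp :: "('a, 'e::euclidean_space) manifold \<Rightarrow> ('a \<Rightarrow> ('a, 'e) bivec) \<Rightarrow> 'a \<Rightarrow>
    ('a, 'e) covec \<Rightarrow> ('a, 'e) tvec" where
  "sharp M \<Theta> p a = (THE v. v \<in> tangent_space M p \<and> (\<forall>b\<in>cotangent_space M p. b v = \<Theta> p a b))"

text \<open>
  The Schouten bracket of two bivector fields, a trivector field with the coefficients
  \<open>[\<Lambda>,\<Theta>]^{ijk} = \<Lambda>^{lk} \<partial>\<^sub>l \<Theta>^{ij} + \<Theta>^{lk} \<partial>\<^sub>l \<Lambda>^{ij}\<close> + cyclic permutations of \<open>(i, j, k)\<close>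
  (up to a sign, which depends on the convention).
\<close>
definition schouten_coeff :: "('a, 'e::euclidean_space) manifold \<Rightarrow> ('a, 'e) chart \<Rightarrow>
    ('a \<Rightarrow> ('a, 'e) bivec) \<Rightarrow> ('a \<Rightarrow> ('a, 'e) bivec) \<Rightarrow> 'e \<Rightarrow> 'e \<Rightarrow> 'e \<Rightarrow> 'a \<Rightarrow> real" where
  "schouten_coeff M c \<Lambda> \<Theta> i j k p =
     (let T = (\<lambda>i j k. \<Sum>l\<in>Basis.
            bivec_coeff M c \<Lambda> l k p * partial c l (bivec_coeff M c \<Theta> i j) p
          + bivec_coeff M c \<Theta> l k p * partial c l (bivec_coeff M c \<Lambda> i j) p)
      in T i j k + T j k i + T k i j)"

definition schouten_bracket :: "('a, 'e::euclidean_space) manifold \<Rightarrow>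
    ('a \<Rightarrow> ('a, 'e) bivec) \<Rightarrow> ('a \<Rightarrow> ('a, 'e) bivec) \<Rightarrow>
    'a \<Rightarrow> ('a, 'e) covec \<Rightarrow> ('a, 'e) covec \<Rightarrow> ('a, 'e) covec \<Rightarrow> real" where
  "schouten_bracket M \<Lambda> \<Theta> p a1 a2 a3 =
     (let c = chart_at M p; D = coord_vec M c p in
      \<Sum>i\<in>Basis. \<Sum>j\<in>Basis. \<Sum>k\<in>Basis.
        schouten_coeff M c \<Lambda> \<Theta> i j k p * a1 (D i) * a2 (D j) * a3 (D k))"

definition poisson_manifold ::
    "('a, 'e::euclidean_space) manifold \<Rightarrow> ('a \<Rightarrow> ('a, 'e) bivec) \<Rightarrow> bool" where
  "poisson_manifold M \<Lambda> \<longleftrightarrow> smooth_manifold M \<and> bivector_field M \<Lambda> \<and>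
     (\<forall>p\<in>points M. \<forall>a1\<in>cotangent_space M p. \<forall>a2\<in>cotangent_space M p. \<forall>a3\<in>cotangent_space M p.
        schouten_bracket M \<Lambda> \<Lambda> p a1 a2 a3 = 0)"

text \<open>
  The Lie derivative of a bivector field. The coefficients
  \<open>X^k \<partial>\<^sub>k \<Lambda>^{ij} - \<Lambda>^{kj} \<partial>\<^sub>k X^i - \<Lambda>^{ik} \<partial>\<^sub>k X^j\<close>
  come from the Leibniz rule and \<open>[X, \<partial>\<^sub>k] = - (\<partial>\<^sub>k X^i) \<partial>\<^sub>i\<close>.
\<close>
definition lie_coeff :: "('a, 'e::euclidean_space) manifold \<Rightarrow> ('a, 'e) chart \<Rightarrow>
    ('a \<Rightarrow> 'a \<times> ('a, 'e) tvec) \<Rightarrow> ('a \<Rightarrow> ('a, 'e) bivec) \<Rightarrow> 'e \<Rightarrow> 'e \<Rightarrow> 'a \<Rightarrow> real" where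
  "lie_coeff M c X \<Lambda> i j p =
     (let X' = (\<lambda>k q. snd (X q) c \<bullet> k) in
      \<Sum>k\<in>Basis. X' k p * partial c k (bivec_coeff M c \<Lambda> i j) p
        - bivec_coeff M c \<Lambda> k j p * partial c k (X' i) p
        - bivec_coeff M c \<Lambda> i k p * partial c k (X' j) p)"

definition lie_derivative :: "('a, 'e::euclidean_space) manifold \<Rightarrow>
    ('a \<Rightarrow> 'a \<times> ('a, 'e) tvec) \<Rightarrow> ('a \<Rightarrow> ('a, 'e) bivec) \<Rightarrow> 'a \<Rightarrow> ('a, 'e) bivec" where
  "lie_derivative M X \<Lambda> p a b =
     (let c = chart_at M p; D = coord_vec M c p in
      1 / 2 * (\<Sum>i\<in>Basis. \<Sum>j\<in>Basis. lie_coeff M c X \<Lambda> i j p * wedge (D i) (D j) a b))"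

definition canonical :: "('a, 'e::euclidean_space) manifold \<Rightarrow> ('a \<Rightarrow> ('a, 'e) bivec) \<Rightarrow>
    ('a \<Rightarrow> 'a \<times> ('a, 'e) tvec) \<Rightarrow> bool" where
  "canonical M \<Lambda> X \<longleftrightarrow> (\<forall>p\<in>points M. \<forall>a\<in>cotangent_space M p. \<forall>b\<in>cotangent_space M p.
     lie_derivative M X \<Lambda> p a b = 0)"

text \<open>
  The tangent lift \<open>d\<^sub>T \<Lambda>\<close>. The coordinates \<open>(x, \<xi>)\<close> (with \<open>\<xi>\<close> the velocities) on the tangent bundle
  have the basis \<open>(i, 0)\<close>, \<open>(0, j)\<close> with \<open>i, j \<in> Basis\<close>; \<open>Dx i\<close> and \<open>D\<xi> j\<close> are the
  corresponding coordinate vectors at \<open>w\<close>.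
\<close>
definition tangent_lift :: "('a, 'e::euclidean_space) manifold \<Rightarrow> ('a \<Rightarrow> ('a, 'e) bivec) \<Rightarrow>
    'a \<times> ('a, 'e) tvec \<Rightarrow> ('a \<times> ('a, 'e) tvec, 'e \<times> 'e) bivec" where
  "tangent_lift M \<Lambda> w a b =
     (let p = fst w; c = chart_at M p;
          Dx = (\<lambda>i. coord_vec (tangent_bundle M) (tangent_chart M c) w (i, 0));
          D\<xi> = (\<lambda>j. coord_vec (tangent_bundle M) (tangent_chart M c) w (0, j))
      in (\<Sum>i\<in>Basis. \<Sum>j\<in>Basis. bivec_coeff M c \<Lambda> i j p * wedge (Dx i) (D\<xi> j) a b)
       + 1 / 2 * (\<Sum>i\<in>Basis. \<Sum>j\<in>Basis. \<Sum>k\<in>Basis.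
           partial c k (bivec_coeff M c \<Lambda> i j) p * (snd w c \<bullet> k) * wedge (D\<xi> i) (D\<xi> j) a b))"

section \<open>Lagrangian submanifolds\<close>

text \<open>Embedded submanifolds, by means of slice charts.\<close>
definition submanifold :: "('a, 'e::euclidean_space) manifold \<Rightarrow> 'a set \<Rightarrow> bool" where
  "submanifold P N \<longleftrightarrow> N \<subseteq> points P \<and>
     (\<exists>k. \<forall>m\<in>N. \<exists>c S. admissible_chart P c \<and> m \<in> fst c \<and> subspace S \<and> dim S = k \<and>
        snd c ` (fst c \<inter> N) = snd c ` fst c \<inter> S)"

text \<open>The tangent space \<open>T\<^sub>m N\<close> in \<open>T\<^sub>m P\<close>: velocities at \<open>m\<close> of smooth curves lying in \<open>N\<close>.\<close>
definition tangent_subspace ::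
    "('a, 'e::euclidean_space) manifold \<Rightarrow> 'a set \<Rightarrow> 'a \<Rightarrow> ('a, 'e) tvec set" where
  "tangent_subspace P N m = {v \<in> tangent_space P m.
     \<exists>\<epsilon>>0. \<exists>\<gamma>. smooth_map (euclidean_manifold {-\<epsilon><..<\<epsilon>}) P \<gamma> \<and> \<gamma> ` {-\<epsilon><..<\<epsilon>} \<subseteq> N \<and> \<gamma> (0::real) = m \<and>
       (\<forall>c\<in>charts_at P m. ((snd c \<circ> \<gamma>) has_vector_derivative v c) (at 0))}"

definition annihilator ::
    "('a, 'e::euclidean_space) manifold \<Rightarrow> 'a set \<Rightarrow> 'a \<Rightarrow> ('a, 'e) covec set" where
  "annihilator P N m = {a \<in> cotangent_space P m. \<forall>v\<in>tangent_subspace P N m. a v = 0}"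

definition lagrangian_submanifold ::
    "('a, 'e::euclidean_space) manifold \<Rightarrow> ('a \<Rightarrow> ('a, 'e) bivec) \<Rightarrow> 'a set \<Rightarrow> bool" where
  "lagrangian_submanifold P \<Theta> N \<longleftrightarrow> submanifold P N \<and>
     (\<forall>m\<in>N. sharp P \<Theta> m ` annihilator P N m =
        sharp P \<Theta> m ` cotangent_space P m \<inter> tangent_subspace P N m)"

end

theory Submission
  imports Defs
begin

text \<open>
  The theorem holds point by point, and at each point it is a statement of linear algebra. Fix
  \<open>p \<in> M\<close> and a chart around it. Let \<open>B\<close> be the matrix of \<open>\<Lambda>\<close> at \<open>p\<close>, let \<open>L\<close> be the derivative of this
  matrix in the direction \<open>X p\<close>, and let \<open>A\<close> be the derivative of the components of \<open>X\<close>, with the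
  transpose \<open>A\<^sup>*\<close>. In the induced coordinates of \<open>TM\<close> at \<open>X p\<close>:

  \<^item> the matrix of \<open>\<L>\<^sub>X \<Lambda>\<close> is \<open>L - A B - B A\<^sup>*\<close> (\<open>lie_derivative_coord_covec\<close>);
  \<^item> the sharp map of \<open>d\<^sub>T \<Lambda>\<close> is \<open>F (a, b) = (- B b, - B a - L b)\<close> (\<open>tangent_lift_coord_covec\<close>);
  \<^item> the tangent space of \<open>X(M)\<close> is the graph of \<open>A\<close> (\<open>tangent_subspace_vector_field\<close>).

  The annihilator of the graph consists of the pairs \<open>(- A\<^sup>* b, b)\<close>, and \<open>F\<close> maps such a pair into the
  graph if and only if \<open>L b = A B b + B A\<^sup>* b\<close>. This is already the vanishing of the Lie derivative,
  and it implies that every covector which \<open>F\<close> maps into the graph has the same image as an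
  annihilating one, so that the two sets in the Lagrangian condition agree
  (\<open>lagrangian_graph_iff\<close>). That \<open>X(M)\<close> is an embedded submanifold is true of every
  vector field: the coordinates \<open>(x, \<xi> - X x)\<close> straighten it (\<open>vector_field_submanifold\<close>).

  The remaining work is to make coordinates available: in a chart, a tangent space is the model
  space and a cotangent space is its dual, for \<open>M\<close> as well as for \<open>TM\<close>. The latter is possible
  because the tangent charts satisfy the same axioms as the charts of \<open>M\<close>.
\<close>

section \<open>Calculus of smooth maps on open sets\<close>

lemma Ck_on_imp_continuous_on: "Ck_on k S f \<Longrightarrow> continuous_on S f"
  by (cases k) (simp_all add: differentiable_imp_continuous_on differentiable_on_def
      differentiable_at_withinI)

lemma Ck_on_SucD: "Ck_on (Suc k) S f \<Longrightarrow> Ck_on k S f"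
proof (induction k arbitrary: f)
  case 0
  then show ?case by (metis Ck_on.simps(1) Ck_on_imp_continuous_on)
next
  case (Suc k)
  from Suc.prems have "\<forall>x\<in>S. f differentiable (at x)"
    and "\<forall>h. Ck_on (Suc k) S (\<lambda>x. frechet_derivative f (at x) h)"
    unfolding Ck_on.simps(2)[of "Suc k"] by blast+
  with Suc.IH show ?case by simp
qed

lemma frechet_derivative_cong_open:
  assumes "open S" "x \<in> S" "\<And>y. y \<in> S \<Longrightarrow> f y = g y"
  shows "frechet_derivative f (at x) = frechet_derivative g (at x)"
proof -
  have "(f has_derivative D) (at x) \<longleftrightarrow> (g has_derivative D) (at x)" for D
    using assms by (metis has_derivative_transform_within_open)
  then show ?thesis by (simp add: frechet_derivative_def)
qed

lemma differentiable_cong_open: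
  assumes "open S" "x \<in> S" "\<And>y. y \<in> S \<Longrightarrow> f y = g y" "f differentiable (at x)"
  shows "g differentiable (at x)"
  using assms unfolding differentiable_def by (metis has_derivative_transform_within_open)

lemma Ck_on_cong:
  assumes "open S" "\<And>x. x \<in> S \<Longrightarrow> f x = g x" "Ck_on k S f"
  shows "Ck_on k S g"
  using assms(2,3)
proof (induction k arbitrary: f g)
  case 0
  then show ?case using continuous_on_cong by fastforce
next
  case (Suc k)
  have f: "\<forall>x\<in>S. f differentiable (at x)"
    "Ck_on k S (\<lambda>x. frechet_derivative f (at x) h)" for h
    using Suc.prems(2) by auto
  have "g differentiable (at x)" if "x \<in> S" for x
    using f(1) differentiable_cong_open[OF \<open>open S\<close> that, of f g] Suc.prems(1) that by blast
  moreover have "Ck_on k S (\<lambda>x. frechet_derivative g (at x) h)" for h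
    by (rule Suc.IH[OF _ f(2)[of h]], subst frechet_derivative_cong_open[OF \<open>open S\<close> _ Suc.prems(1)])
      auto
  ultimately show ?case by simp
qed

lemma Ck_on_subset: "Ck_on k S f \<Longrightarrow> T \<subseteq> S \<Longrightarrow> Ck_on k T f"
  by (induction k arbitrary: f) (auto intro: continuous_on_subset)

text \<open>The derivative may be given by any formula, which is how the closure properties below
  are proved by induction on \<open>k\<close>.\<close>

lemma Ck_on_SucI:
  assumes "open S" "\<And>x. x \<in> S \<Longrightarrow> (f has_derivative f' x) (at x)"
    "\<And>h. Ck_on k S (\<lambda>x. f' x h)"
  shows "Ck_on (Suc k) S f"
proof -
  have "frechet_derivative f (at x) = f' x" if "x \<in> S" for x
    using assms(2)[OF that] frechet_derivative_at by metis
  then have "Ck_on k S (\<lambda>x. frechet_derivative f (at x) h)" for h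
    using Ck_on_cong[OF assms(1) _ assms(3)[of h]] by simp
  moreover have "f differentiable (at x)" if "x \<in> S" for x
    using assms(2)[OF that] by (rule differentiableI)
  ultimately show ?thesis by simp
qed

lemma Ck_on_const: "open S \<Longrightarrow> Ck_on k S (\<lambda>x. c)"
  by (induction k arbitrary: c)
    (simp, rule Ck_on_SucI[where f' = "\<lambda>_ _. 0"], auto)

lemma Ck_on_bounded_linear: "bounded_linear L \<Longrightarrow> open S \<Longrightarrow> Ck_on k S L"
proof (cases k)
  case 0
  assume "bounded_linear L"
  with 0 show ?thesis by (simp add: linear_continuous_on)
next
  case (Suc n)
  assume "bounded_linear L" "open S"
  then show ?thesis unfolding Suc
    by (intro Ck_on_SucI[where f' = "\<lambda>_. L"] bounded_linear_imp_has_derivative Ck_on_const)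
qed

lemma Ck_on_add:
  assumes "open S" "Ck_on k S f" "Ck_on k S g"
  shows "Ck_on k S (\<lambda>x. f x + g x)"
  using assms(2,3)
proof (induction k arbitrary: f g)
  case (Suc k)
  then show ?case using assms(1)
    by (intro Ck_on_SucI[where f' = "\<lambda>x h. frechet_derivative f (at x) h + frechet_derivative g (at x) h"]
      has_derivative_add) (auto simp: frechet_derivative_works)
qed (simp add: continuous_on_add)

lemma Ck_on_sum:
  assumes "open S" "\<And>i. i \<in> I \<Longrightarrow> Ck_on k S (f i)"
  shows "Ck_on k S (\<lambda>x. \<Sum>i\<in>I. f i x)"
  using assms(2) by (induction I rule: infinite_finite_induct)
    (auto intro: Ck_on_const Ck_on_add assms(1))

lemma Ck_on_bilinear:
  assumes "bounded_bilinear B" "open S" "Ck_on k S f" "Ck_on k S g"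
  shows "Ck_on k S (\<lambda>x. B (f x) (g x))"
  using assms(3,4)
proof (induction k arbitrary: f g)
  case 0
  then show ?case by (simp add: bounded_bilinear.continuous_on[OF assms(1)])
next
  case (Suc k)
  have "Ck_on k S f" "Ck_on k S g" using Suc.prems Ck_on_SucD by blast+
  then show ?case using assms(1,2) Suc
    by (intro Ck_on_SucI[where f' = "\<lambda>x h. B (f x) (frechet_derivative g (at x) h)
          + B (frechet_derivative f (at x) h) (g x)"]
      bounded_bilinear.FDERIV[OF assms(1)] Ck_on_add) (auto simp: frechet_derivative_works)
qed

lemma Ck_on_linear_comp:
  assumes "bounded_linear L" "open S" "Ck_on k S f"
  shows "Ck_on k S (\<lambda>x. L (f x))"
  using assms(3)
proof (induction k arbitrary: f)
  case 0
  then show ?case by (simp add: bounded_linear.continuous_on[OF assms(1)])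
next
  case (Suc k)
  then show ?case using assms(1,2)
    by (intro Ck_on_SucI[where f' = "\<lambda>x h. L (frechet_derivative f (at x) h)"]
      bounded_linear.has_derivative[OF assms(1)]) (auto simp: frechet_derivative_works)
qed

lemma linear_basis_expansion:
  fixes f :: "'a::euclidean_space \<Rightarrow> 'b::real_normed_vector"
  assumes "linear f"
  shows "f v = (\<Sum>i\<in>Basis. (v \<bullet> i) *\<^sub>R f i)"
proof -
  have "f v = f (\<Sum>i\<in>Basis. (v \<bullet> i) *\<^sub>R i)" by (simp add: euclidean_representation)
  then show ?thesis by (simp only: linear_sum[OF assms] linear_scale[OF assms])
qed

text \<open>The chain rule expresses the derivative of \<open>f \<circ> g\<close> through the maps
  \<open>x \<mapsto> D f (g x) h'\<close>, whose direction \<open>h' = D g x h\<close> varies with \<open>x\<close>, whereas \<^const>\<open>Ck_on\<close> speaks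
  of fixed directions only. Expanding \<open>h'\<close> in the basis leaves the directions \<open>i \<in> Basis\<close>, to
  which the induction hypothesis applies.\<close>

lemma Ck_on_compose:
  fixes f :: "'b::euclidean_space \<Rightarrow> 'c::real_normed_vector" and g :: "'a::real_normed_vector \<Rightarrow> 'b"
  assumes "open S" "Ck_on k S g" "Ck_on k T f" "g ` S \<subseteq> T"
  shows "Ck_on k S (\<lambda>x. f (g x))"
  using assms(2,3)
proof (induction k arbitrary: f)
  case 0
  then show ?case using continuous_on_compose2[of T f S g] assms(4) by simp
next
  case (Suc k)
  let ?f' = "\<lambda>y. frechet_derivative f (at y)" and ?g' = "\<lambda>x. frechet_derivative g (at x)"
  have "(f has_derivative ?f' (g x)) (at (g x))" "(g has_derivative ?g' x) (at x)" if "x \<in> S" for x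
    using Suc.prems that assms(4) by (auto simp: frechet_derivative_works)
  then have "((\<lambda>x. f (g x)) has_derivative (\<lambda>h. ?f' (g x) (?g' x h))) (at x)" if "x \<in> S" for x
    using that has_derivative_compose by blast
  moreover have "?f' (g x) (?g' x h) = (\<Sum>i\<in>Basis. (?g' x h \<bullet> i) *\<^sub>R ?f' (g x) i)" if "x \<in> S" for x h
    using \<open>\<And>x. x \<in> S \<Longrightarrow> (f has_derivative ?f' (g x)) (at (g x))\<close>[OF that]
    by (intro linear_basis_expansion has_derivative_linear)
  ultimately have "((\<lambda>x. f (g x)) has_derivative (\<lambda>h. \<Sum>i\<in>Basis. (?g' x h \<bullet> i) *\<^sub>R ?f' (g x) i)) (at x)"
    if "x \<in> S" for x using that by simp
  moreover have "Ck_on k S (\<lambda>x. \<Sum>i\<in>Basis. (?g' x h \<bullet> i) *\<^sub>R ?f' (g x) i)" for h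
    using Suc.prems Ck_on_SucD[OF Suc.prems(1)] assms(1)
    by (intro Ck_on_sum Ck_on_bilinear[OF bounded_bilinear_scaleR] Suc.IH
        Ck_on_linear_comp[OF bounded_linear_inner_left]) auto
  ultimately show ?case by (rule Ck_on_SucI[OF assms(1)])
qed

lemma smooth_onD: "smooth_on S f \<Longrightarrow> x \<in> S \<Longrightarrow> (f has_derivative frechet_derivative f (at x)) (at x)"
  unfolding smooth_on_def using Ck_on.simps(2)[of 0 S f] frechet_derivative_works by blast

lemma smooth_on_imp_continuous_on: "smooth_on S f \<Longrightarrow> continuous_on S f"
  by (meson smooth_on_def Ck_on_imp_continuous_on)

lemma smooth_on_cong:
  "smooth_on S f \<Longrightarrow> open S \<Longrightarrow> (\<And>x. x \<in> S \<Longrightarrow> f x = g x) \<Longrightarrow> smooth_on S g"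
  unfolding smooth_on_def using Ck_on_cong by metis

lemma smooth_on_subset: "smooth_on S f \<Longrightarrow> T \<subseteq> S \<Longrightarrow> smooth_on T f"
  unfolding smooth_on_def using Ck_on_subset by blast

lemma smooth_on_bounded_linear: "bounded_linear L \<Longrightarrow> open S \<Longrightarrow> smooth_on S L"
  unfolding smooth_on_def using Ck_on_bounded_linear by blast

lemma smooth_on_add: "smooth_on S f \<Longrightarrow> smooth_on S g \<Longrightarrow> open S \<Longrightarrow> smooth_on S (\<lambda>x. f x + g x)"
  unfolding smooth_on_def using Ck_on_add by blast

lemma smooth_on_const: "open S \<Longrightarrow> smooth_on S (\<lambda>x. c)"
  unfolding smooth_on_def using Ck_on_const by blast

lemma smooth_on_linear_comp:
  "bounded_linear L \<Longrightarrow> smooth_on S f \<Longrightarrow> open S \<Longrightarrow> smooth_on S (\<lambda>x. L (f x))"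
  unfolding smooth_on_def using Ck_on_linear_comp by blast

lemma smooth_on_compose:
  fixes f :: "'b::euclidean_space \<Rightarrow> 'c::real_normed_vector"
  shows "smooth_on T f \<Longrightarrow> smooth_on S g \<Longrightarrow> g ` S \<subseteq> T \<Longrightarrow> open S \<Longrightarrow> smooth_on S (\<lambda>x. f (g x))"
  unfolding smooth_on_def using Ck_on_compose by blast

lemma smooth_on_Pair:
  assumes "smooth_on S f" "smooth_on S g" "open S"
  shows "smooth_on S (\<lambda>x. (f x, g x))"
proof -
  have "bounded_linear (\<lambda>x::'b. (x, 0::'c))" "bounded_linear (\<lambda>y::'c. (0::'b, y))"
    by (simp_all add: bounded_linear_Pair bounded_linear_ident bounded_linear_zero)
  then have "smooth_on S (\<lambda>x. (f x, 0) + (0, g x))"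
    using assms by (intro smooth_on_add) (auto intro: smooth_on_linear_comp)
  then show ?thesis by simp
qed

text \<open>Joint smoothness follows from the smoothness in \<open>x\<close> for each fixed direction, because the
  derivative is linear in \<open>h\<close>: it is a combination of its values on the basis, with the coordinates
  of \<open>h\<close> as coefficients.\<close>

lemma smooth_on_derivative:
  fixes f :: "'b::euclidean_space \<Rightarrow> 'c::real_normed_vector"
  assumes "smooth_on S f" "open S"
  shows "smooth_on (S \<times> UNIV) (\<lambda>(x, h). frechet_derivative f (at x) h)"
proof -
  let ?T = "S \<times> (UNIV :: 'b set)"
  have o: "open ?T" using assms(2) by (simp add: open_Times)
  have "smooth_on ?T (\<lambda>z. \<Sum>i\<in>Basis. (snd z \<bullet> i) *\<^sub>R frechet_derivative f (at (fst z)) i)"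
    unfolding smooth_on_def
  proof (intro allI Ck_on_sum[OF o] Ck_on_bilinear[OF bounded_bilinear_scaleR o])
    fix k and i :: 'b
    show "Ck_on k ?T (\<lambda>z. snd z \<bullet> i)"
      by (intro Ck_on_linear_comp[OF bounded_linear_inner_left o] Ck_on_bounded_linear
          bounded_linear_snd o)
    have "Ck_on k S (\<lambda>x. frechet_derivative f (at x) i)"
      using assms(1) unfolding smooth_on_def by (metis Ck_on.simps(2))
    then show "Ck_on k ?T (\<lambda>z. frechet_derivative f (at (fst z)) i)"
      using Ck_on_compose[OF o, where g = fst and T = S and f = "\<lambda>x. frechet_derivative f (at x) i"]
        Ck_on_bounded_linear[OF bounded_linear_fst o] by auto
  qed
  then show ?thesis
  proof (rule smooth_on_cong[OF _ o])
    fix z assume "z \<in> ?T"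
    then have "fst z \<in> S" by auto
    then have "linear (frechet_derivative f (at (fst z)))"
      by (rule has_derivative_linear[OF smooth_onD[OF assms(1)]])
    from linear_basis_expansion[OF this, of "snd z", symmetric]
    show "(\<Sum>i\<in>Basis. (snd z \<bullet> i) *\<^sub>R frechet_derivative f (at (fst z)) i)
        = (case z of (x, h) \<Rightarrow> frechet_derivative f (at x) h)"
      unfolding case_prod_unfold .
  qed
qed

section \<open>Charts\<close>

lemma chart_on_open:
  assumes "chart_on T c"
  shows "openin T (fst c)" "open (snd c ` fst c)" "inj_on (snd c) (fst c)"
proof -
  show o: "openin T (fst c)" "open (snd c ` fst c)" using assms by (auto simp: chart_on_def)
  have "inj_on (snd c) (topspace (subtopology T (fst c)))"
    using assms homeomorphic_imp_injective_map chart_on_def by metis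
  then show "inj_on (snd c) (fst c)" using openin_subset[OF o(1)] by (simp add: Int_absorb1)
qed

lemma chart_inv_chart: "chart_on T c \<Longrightarrow> p \<in> fst c \<Longrightarrow> chart_inv c (snd c p) = p"
  unfolding chart_inv_def by (simp add: chart_on_open(3))

lemma chart_chart_inv: "x \<in> snd c ` fst c \<Longrightarrow> snd c (chart_inv c x) = x"
  unfolding chart_inv_def by (simp add: f_inv_into_f)

lemma chart_inv_in: "x \<in> snd c ` fst c \<Longrightarrow> chart_inv c x \<in> fst c"
  unfolding chart_inv_def by (rule inv_into_into)

lemma chart_open_image:
  assumes "chart_on T c" "openin T U"
  shows "open (snd c ` (fst c \<inter> U))"
proof -
  have "open_map (subtopology T (fst c)) (top_of_set (snd c ` fst c)) (snd c)"
    using assms(1) homeomorphic_imp_open_map unfolding chart_on_def by blast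
  moreover have "openin (subtopology T (fst c)) (fst c \<inter> U)"
    using assms(2) by (rule openin_subtopology_Int2)
  ultimately have "openin (top_of_set (snd c ` fst c)) (snd c ` (fst c \<inter> U))"
    unfolding open_map_def by blast
  then show ?thesis using openin_open_eq[OF chart_on_open(2)[OF assms(1)]] by blast
qed

lemma chart_open_vimage:
  assumes "chart_on T c" "open S"
  shows "openin T {p \<in> fst c. snd c p \<in> S}"
proof -
  have sub: "fst c \<subseteq> topspace T" using chart_on_open(1)[OF assms(1)] openin_subset by blast
  have "continuous_map (subtopology T (fst c)) (top_of_set (snd c ` fst c)) (snd c)"
    using assms(1) homeomorphic_imp_continuous_map unfolding chart_on_def by blast
  moreover have "openin (top_of_set (snd c ` fst c)) (snd c ` fst c \<inter> S)"
    using assms(2) by (rule openin_open_Int)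
  ultimately have "openin (subtopology T (fst c))
      {p \<in> topspace (subtopology T (fst c)). snd c p \<in> snd c ` fst c \<inter> S}"
    by (rule openin_continuous_map_preimage)
  moreover have "{p \<in> topspace (subtopology T (fst c)). snd c p \<in> snd c ` fst c \<inter> S}
      = {p \<in> fst c. snd c p \<in> S}" using sub by auto
  ultimately show ?thesis using openin_trans_full chart_on_open(1)[OF assms(1)] by metis
qed

text \<open>To be a homeomorphism onto its image, a coordinate map has to be injective, continuous and open;
  openness in the subspace is the same as openness because both the domain and the image are open.\<close>

lemma chart_onI:
  assumes "openin T (fst c)" "open (snd c ` fst c)" "inj_on (snd c) (fst c)"
    and vimage: "\<And>S. open S \<Longrightarrow> openin T {p \<in> fst c. snd c p \<in> S}"
    and image: "\<And>U. openin T U \<Longrightarrow> U \<subseteq> fst c \<Longrightarrow> open (snd c ` U)"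
  shows "chart_on T c"
proof -
  let ?T = "subtopology T (fst c)" and ?E = "top_of_set (snd c ` fst c)"
  have top: "topspace ?T = fst c" using openin_subset[OF assms(1)] by auto
  have "continuous_map ?T ?E (snd c)"
    unfolding continuous_map top
  proof (intro conjI allI impI)
    fix U assume "openin ?E U"
    then have "open U" using openin_open_eq[OF assms(2)] by blast
    then show "openin ?T {p \<in> fst c. snd c p \<in> U}"
      using vimage openin_subset_topspace_eq assms(1)
      by (metis (no_types, lifting) mem_Collect_eq openin_open_subtopology subsetI)
  qed auto
  moreover have "open_map ?T ?E (snd c)"
    unfolding open_map_def
  proof (intro allI impI)
    fix U assume "openin ?T U"
    then have "openin T U" "U \<subseteq> fst c" using openin_open_subtopology[OF assms(1)] by auto
    then show "openin ?E (snd c ` U)" using image openin_open_eq[OF assms(2)] by blast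
  qed
  ultimately have "homeomorphic_map ?T ?E (snd c)"
    by (rule bijective_open_imp_homeomorphic_map) (use assms(3) top in auto)
  then show ?thesis using assms(1,2) by (simp add: chart_on_def)
qed

lemma transition_chart:
  assumes "chart_on T c" "p \<in> fst c"
  shows "transition c d (snd c p) = snd d p"
  using chart_inv_chart[OF assms] by (simp add: transition_def)

lemma open_image_diffeo:
  assumes c: "chart_on T c" and \<psi>: "smooth_on (\<phi> ` snd c ` fst c) \<psi>"
    and inv: "\<And>z. z \<in> snd c ` fst c \<Longrightarrow> \<psi> (\<phi> z) = z" and o: "open (\<phi> ` snd c ` fst c)"
    and V: "open V" "V \<subseteq> snd c ` fst c"
  shows "open (\<phi> ` V)"
proof -
  have "\<phi> ` V = \<phi> ` snd c ` fst c \<inter> \<psi> -` V"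
  proof (intro equalityI subsetI)
    fix y assume "y \<in> \<phi> ` V"
    then show "y \<in> \<phi> ` snd c ` fst c \<inter> \<psi> -` V" using inv V(2) by auto
  next
    fix y assume "y \<in> \<phi> ` snd c ` fst c \<inter> \<psi> -` V"
    then obtain z where "z \<in> snd c ` fst c" "y = \<phi> z" "\<psi> y \<in> V" by blast
    then show "y \<in> \<phi> ` V" using inv by (metis imageI)
  qed
  then show ?thesis
    using continuous_open_preimage[OF smooth_on_imp_continuous_on[OF \<psi>] o V(1)] by simp
qed

text \<open>The slice charts of the image of a vector field arise from tangent charts in this way; that they
  stay compatible with the atlas is \<open>compatible_diffeo\<close>.\<close>

lemma chart_on_diffeo:
  assumes c: "chart_on T c"
    and \<phi>: "smooth_on (snd c ` fst c) \<phi>" and \<psi>: "smooth_on (\<phi> ` snd c ` fst c) \<psi>"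
    and inv: "\<And>z. z \<in> snd c ` fst c \<Longrightarrow> \<psi> (\<phi> z) = z" and o: "open (\<phi> ` snd c ` fst c)"
  shows "chart_on T (fst c, \<phi> \<circ> snd c)"
proof (rule chart_onI; simp only: fst_conv snd_conv)
  show "openin T (fst c)" by (rule chart_on_open(1)[OF c])
  show "open ((\<phi> \<circ> snd c) ` fst c)" using o by (simp add: image_comp)
  have "inj_on \<phi> (snd c ` fst c)" using inv by (metis inj_on_def)
  then show "inj_on (\<phi> \<circ> snd c) (fst c)" using chart_on_open(3)[OF c] by (intro comp_inj_on)
  show "openin T {p \<in> fst c. (\<phi> \<circ> snd c) p \<in> S}" if "open S" for S
  proof -
    have "open (snd c ` fst c \<inter> \<phi> -` S)"
      using continuous_open_preimage[OF smooth_on_imp_continuous_on[OF \<phi>] chart_on_open(2)[OF c] that] .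
    from chart_open_vimage[OF c this] show ?thesis
      by (rule back_subst[of "openin T"]) auto
  qed
  show "open ((\<phi> \<circ> snd c) ` U)" if "openin T U" "U \<subseteq> fst c" for U
  proof -
    have "open (snd c ` U)" using chart_open_image[OF c that(1)] that(2) by (simp add: Int_absorb1)
    then have "open (\<phi> ` snd c ` U)" using that(2) by (intro open_image_diffeo[OF c \<psi> inv o]) auto
    then show ?thesis by (simp add: image_comp)
  qed
qed

lemma compatible_diffeo:
  assumes c: "chart_on T c" and d: "chart_on T d" and cd: "compatible c d"
    and \<phi>: "smooth_on (snd c ` fst c) \<phi>" and \<psi>: "smooth_on (\<phi> ` snd c ` fst c) \<psi>"
    and inv: "\<And>z. z \<in> snd c ` fst c \<Longrightarrow> \<psi> (\<phi> z) = z" and o: "open (\<phi> ` snd c ` fst c)"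
  shows "compatible (fst c, \<phi> \<circ> snd c) d"
proof -
  let ?c = "(fst c, \<phi> \<circ> snd c)" and ?W = "snd c ` (fst c \<inter> fst d)" and ?W' = "snd d ` (fst c \<inter> fst d)"
  have c': "chart_on T ?c" by (rule chart_on_diffeo[OF c \<phi> \<psi> inv o])
  have W: "open ?W" "?W \<subseteq> snd c ` fst c" using chart_open_image[OF c chart_on_open(1)[OF d]] by auto
  have W': "open ?W'" using chart_open_image[OF d chart_on_open(1)[OF c]] by (simp add: Int_commute)
  have oW: "open (\<phi> ` ?W)" by (rule open_image_diffeo[OF c \<psi> inv o W])
  have "smooth_on (\<phi> ` ?W) (\<lambda>y. transition c d (\<psi> y))"
  proof (rule smooth_on_compose[where f = "transition c d" and g = \<psi>, OF _ _ _ oW])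
    show "smooth_on ?W (transition c d)" using cd by (simp add: compatible_def)
    show "smooth_on (\<phi> ` ?W) \<psi>" by (rule smooth_on_subset[OF \<psi> image_mono[OF W(2)]])
    show "\<psi> ` \<phi> ` ?W \<subseteq> ?W" using inv W(2) by auto
  qed
  then have "smooth_on (\<phi> ` ?W) (transition ?c d)"
  proof (rule smooth_on_cong[OF _ oW])
    fix y assume "y \<in> \<phi> ` ?W"
    then obtain p where p: "p \<in> fst c" "y = \<phi> (snd c p)" by blast
    with transition_chart[OF c', of p d] transition_chart[OF c, of p d] inv
    show "transition c d (\<psi> y) = transition ?c d y" by simp
  qed
  moreover have "smooth_on ?W' (transition d ?c)"
  proof -
    have "smooth_on ?W' (\<lambda>y. \<phi> (transition d c y))"
    proof (rule smooth_on_compose[where g = "transition d c", OF \<phi> _ _ W'])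
      show "smooth_on ?W' (transition d c)" using cd by (simp add: compatible_def)
      show "transition d c ` ?W' \<subseteq> snd c ` fst c" using transition_chart[OF d, of _ c] by auto
    qed
    then show ?thesis by (rule smooth_on_cong[OF _ W']) (simp add: transition_def)
  qed
  ultimately show ?thesis by (simp add: compatible_def image_comp)
qed

section \<open>Tangent and cotangent spaces in a chart\<close>

text \<open>The axioms on the atlas, as a locale that is interpreted for \<open>M\<close> as well as for its tangent
  bundle, so that one set of lemmas on tangent vectors serves both.\<close>

locale smooth_structure =
  fixes P :: "('a, 'e::euclidean_space) manifold"
  assumes charts: "\<And>c. c \<in> atlas P \<Longrightarrow> chart_on (mtop P) c"
    and compatible: "\<And>c d. c \<in> atlas P \<Longrightarrow> d \<in> atlas P \<Longrightarrow> compatible c d"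
    and cover: "(\<Union>c\<in>atlas P. fst c) = points P"
begin

abbreviation dtrans :: "('a, 'e) chart \<Rightarrow> ('a, 'e) chart \<Rightarrow> 'a \<Rightarrow> 'e \<Rightarrow> 'e" where
  "dtrans c d p \<equiv> frechet_derivative (transition c d) (at (snd c p))"

lemma charts_atD:
  assumes "c \<in> charts_at P p"
  shows "c \<in> atlas P" "p \<in> fst c" "chart_on (mtop P) c"
  using assms charts by (auto simp: charts_at_def)

lemma chart_at_charts_at: "p \<in> points P \<Longrightarrow> chart_at P p \<in> charts_at P p"
  unfolding chart_at_def by (rule someI_ex) (use cover in \<open>unfold charts_at_def, blast\<close>)

lemma open_overlap: "c \<in> atlas P \<Longrightarrow> d \<in> atlas P \<Longrightarrow> open (snd c ` (fst c \<inter> fst d))"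
  using chart_open_image charts chart_on_open(1) by blast

lemma smooth_transition:
  "c \<in> atlas P \<Longrightarrow> d \<in> atlas P \<Longrightarrow> smooth_on (snd c ` (fst c \<inter> fst d)) (transition c d)"
  using compatible by (auto simp: compatible_def)

lemma has_derivative_transition:
  assumes "c \<in> charts_at P p" "d \<in> charts_at P p"
  shows "(transition c d has_derivative dtrans c d p) (at (snd c p))"
  using smooth_onD[OF smooth_transition] charts_atD[OF assms(1)] charts_atD[OF assms(2)] by blast

lemma linear_dtrans:
  "c \<in> charts_at P p \<Longrightarrow> d \<in> charts_at P p \<Longrightarrow> linear (dtrans c d p)"
  using has_derivative_transition has_derivative_linear by blast

text \<open>The cocycle identity: by the chain rule, because the transition maps satisfy it on the
  common domain of the three charts.\<close>

lemma dtrans_dtrans: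
  assumes c: "c \<in> charts_at P p" and d: "d \<in> charts_at P p" and e: "e \<in> charts_at P p"
  shows "dtrans d e p (dtrans c d p x) = dtrans c e p x"
proof -
  note C = charts_atD[OF c] and D = charts_atD[OF d] and E = charts_atD[OF e]
  have tp: "transition c d (snd c p) = snd d p" by (rule transition_chart[OF C(3,2)])
  have "(transition d e has_derivative dtrans d e p) (at (transition c d (snd c p)))"
    unfolding tp by (rule has_derivative_transition[OF d e])
  then have "((\<lambda>y. transition d e (transition c d y)) has_derivative
      (\<lambda>x. dtrans d e p (dtrans c d p x))) (at (snd c p))"
    by (rule has_derivative_compose[OF has_derivative_transition[OF c d]])
  then have "(transition c e has_derivative (\<lambda>x. dtrans d e p (dtrans c d p x))) (at (snd c p))"
  proof (rule has_derivative_transform_within_open)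
    show "open (snd c ` (fst c \<inter> fst d))" by (rule open_overlap[OF C(1) D(1)])
    show "snd c p \<in> snd c ` (fst c \<inter> fst d)" using C D by blast
    fix y assume "y \<in> snd c ` (fst c \<inter> fst d)"
    then show "transition d e (transition c d y) = transition c e y"
      using transition_chart[OF C(3), of _ d] transition_chart[OF C(3), of _ e]
        transition_chart[OF D(3), of _ e] by auto
  qed
  from fun_cong[OF frechet_derivative_at[OF this], of x] show ?thesis .
qed

lemma dtrans_self:
  assumes c: "c \<in> charts_at P p"
  shows "dtrans c c p x = x"
proof -
  note C = charts_atD[OF c]
  have "(transition c c has_derivative (\<lambda>x. x)) (at (snd c p))"
    by (rule has_derivative_transform_within_open[OF has_derivative_ident chart_on_open(2)[OF C(3)]])
      (use C transition_chart[OF C(3), of _ c] in auto)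
  from fun_cong[OF frechet_derivative_at[OF this], of x] show ?thesis by (rule sym)
qed

lemma coord_vec_in_tangent_space:
  "c \<in> charts_at P p \<Longrightarrow> coord_vec P c p x \<in> tangent_space P p"
  using dtrans_dtrans by (auto simp: tangent_space_def coord_vec_def)

lemma coord_vec_self: "c \<in> charts_at P p \<Longrightarrow> coord_vec P c p x c = x"
  by (simp add: coord_vec_def dtrans_self)

lemma coord_vec_of_coords:
  assumes "v \<in> tangent_space P p" "c \<in> charts_at P p"
  shows "coord_vec P c p (v c) = v"
proof (rule ext)
  fix d
  have "d \<in> charts_at P p \<Longrightarrow> v d = dtrans c d p (v c)" "d \<notin> charts_at P p \<Longrightarrow> v d = 0"
    using assms unfolding tangent_space_def by blast+
  then show "coord_vec P c p (v c) d = v d" by (simp add: coord_vec_def)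
qed

lemma coord_vec_linear:
  assumes "c \<in> charts_at P p"
  shows "coord_vec P c p (x + y) = (\<lambda>d. coord_vec P c p x d + coord_vec P c p y d)"
    and "coord_vec P c p (r *\<^sub>R x) = (\<lambda>d. r *\<^sub>R coord_vec P c p x d)"
  using linear_add[OF linear_dtrans[OF assms]] linear_scale[OF linear_dtrans[OF assms]]
  by (auto simp: coord_vec_def)

lemma coord_covec_coord_vec:
  "c \<in> charts_at P p \<Longrightarrow> coord_covec P c p \<alpha> (coord_vec P c p x) = x \<bullet> \<alpha>"
  by (simp add: coord_covec_def coord_vec_in_tangent_space coord_vec_self)

lemma coord_covec_in_cotangent_space:
  assumes c: "c \<in> charts_at P p"
  shows "coord_covec P c p \<alpha> \<in> cotangent_space P p"
proof -
  have "(\<lambda>d. u d + v d) \<in> tangent_space P p" if "u \<in> tangent_space P p" "v \<in> tangent_space P p" for u v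
    using coord_vec_in_tangent_space[OF c, of "u c + v c"] coord_vec_of_coords[OF _ c] that
    by (simp add: coord_vec_linear[OF c])
  moreover have "(\<lambda>d. r *\<^sub>R v d) \<in> tangent_space P p" if "v \<in> tangent_space P p" for r v
    using coord_vec_in_tangent_space[OF c, of "r *\<^sub>R v c"] coord_vec_of_coords[OF _ c] that
    by (simp add: coord_vec_linear[OF c])
  ultimately show ?thesis
    unfolding cotangent_space_def coord_covec_def by (simp add: inner_add_left)
qed

text \<open>A linear functional is determined by its values on the coordinate vectors. Collected into one
  vector \<open>\<alpha>\<close>, these values represent it as \<open>coord_covec P c p \<alpha>\<close>, where \<open>\<alpha>\<close> need not be a basis vector,
  and the pairing with tangent vectors becomes the inner product.\<close>

lemma cotangent_space_eq:
  assumes c: "c \<in> charts_at P p"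
  shows "cotangent_space P p = range (coord_covec P c p)"
proof (intro equalityI subsetI)
  fix a assume a: "a \<in> cotangent_space P p"
  define \<alpha> where "\<alpha> = (\<Sum>i\<in>Basis. a (coord_vec P c p i) *\<^sub>R i)"
  have lin: "linear (\<lambda>x. a (coord_vec P c p x))"
    using a coord_vec_in_tangent_space[OF c]
    by (intro linearI) (simp_all add: coord_vec_linear[OF c] cotangent_space_def)
  have coords: "a (coord_vec P c p x) = x \<bullet> \<alpha>" for x
    by (subst linear_basis_expansion[OF lin]) (simp add: \<alpha>_def inner_sum_right mult.commute)
  have "a v = coord_covec P c p \<alpha> v" if "v \<in> tangent_space P p" for v
    using coords[of "v c"] that coord_vec_of_coords[OF that c] by (simp add: coord_covec_def)
  moreover have "a v = coord_covec P c p \<alpha> v" if "v \<notin> tangent_space P p" for v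
    using that a unfolding cotangent_space_def coord_covec_def by simp
  ultimately have "a = coord_covec P c p \<alpha>" by blast
  then show "a \<in> range (coord_covec P c p)" by blast
qed (use coord_covec_in_cotangent_space[OF c] in auto)

text \<open>Covectors separate tangent vectors, so the vector in the definition of \<^const>\<open>sharp\<close> is
  determined by its pairings, and the sharp map can be read off from the bivector in one chart.\<close>

lemma sharp_coord_covec:
  assumes c: "c \<in> charts_at P p"
    and \<Theta>: "\<And>\<beta>. \<Theta> p (coord_covec P c p \<alpha>) (coord_covec P c p \<beta>) = y \<bullet> \<beta>"
  shows "sharp P \<Theta> p (coord_covec P c p \<alpha>) = coord_vec P c p y"
  unfolding sharp_def
proof (rule the_equality)
  show "coord_vec P c p y \<in> tangent_space P p \<and>
      (\<forall>b\<in>cotangent_space P p. b (coord_vec P c p y) = \<Theta> p (coord_covec P c p \<alpha>) b)"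
    using coord_vec_in_tangent_space[OF c] \<Theta> coord_covec_coord_vec[OF c]
    by (auto simp: cotangent_space_eq[OF c])
next
  fix v assume v: "v \<in> tangent_space P p \<and>
      (\<forall>b\<in>cotangent_space P p. b v = \<Theta> p (coord_covec P c p \<alpha>) b)"
  then have "v c \<bullet> \<beta> = y \<bullet> \<beta>" for \<beta>
    using \<Theta>[of \<beta>] coord_covec_in_cotangent_space[OF c, of \<beta>] by (simp add: coord_covec_def)
  then have "v c = y" using vector_eq_rdot by blast
  then show "v = coord_vec P c p y" using coord_vec_of_coords[of v, OF _ c] v by metis
qed

end

section \<open>The tangent bundle\<close>

context smooth_structure
begin

lemma tangent_chart_simps:
  "(p, v) \<in> fst (tangent_chart P c) \<longleftrightarrow> p \<in> fst c \<and> v \<in> tangent_space P p"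
  "snd (tangent_chart P c) (p, v) = (snd c p, v c)"
  by (auto simp: tangent_chart_def)

lemma tangent_chart_image:
  assumes "c \<in> atlas P"
  shows "snd (tangent_chart P c) ` (fst (tangent_chart P c) \<inter> fst (tangent_chart P d))
    = snd c ` (fst c \<inter> fst d) \<times> UNIV" (is "?L = ?R")
proof (intro equalityI subsetI)
  fix z assume "z \<in> ?R"
  then obtain p \<xi> where p: "p \<in> fst c" "p \<in> fst d" "z = (snd c p, \<xi>)" by auto
  then have c: "c \<in> charts_at P p" using assms by (simp add: charts_at_def)
  have "z = snd (tangent_chart P c) (p, coord_vec P c p \<xi>)"
    using p coord_vec_self[OF c] by (simp add: tangent_chart_simps)
  then show "z \<in> ?L" using p coord_vec_in_tangent_space[OF c] tangent_chart_simps(1) by blast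
qed (auto simp: tangent_chart_def)

lemma tangent_chart_image_all:
  "c \<in> atlas P \<Longrightarrow> snd (tangent_chart P c) ` fst (tangent_chart P c) = snd c ` fst c \<times> UNIV"
  using tangent_chart_image[of c c] by simp

lemma tangent_chart_inj:
  assumes "c \<in> atlas P"
  shows "inj_on (snd (tangent_chart P c)) (fst (tangent_chart P c))"
proof (rule inj_onI)
  fix w w' assume w: "w \<in> fst (tangent_chart P c)" "w' \<in> fst (tangent_chart P c)"
    and eq: "snd (tangent_chart P c) w = snd (tangent_chart P c) w'"
  obtain p v p' v' where [simp]: "w = (p, v)" "w' = (p', v')" by fastforce
  have p: "p \<in> fst c" "p' \<in> fst c" "v \<in> tangent_space P p" "v' \<in> tangent_space P p'"
    "snd c p = snd c p'" "v c = v' c" using w eq by (auto simp: tangent_chart_simps)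
  then have "p = p'" using chart_on_open(3)[OF charts[OF assms]] by (meson inj_onD)
  moreover have "c \<in> charts_at P p" using assms p by (simp add: charts_at_def)
  ultimately show "w = w'" using p coord_vec_of_coords by (metis \<open>w = _\<close> \<open>w' = _\<close>)
qed

lemma tangent_chart_inv:
  assumes "c \<in> atlas P" "x \<in> snd c ` fst c"
  shows "chart_inv (tangent_chart P c) (x, \<xi>) = (chart_inv c x, coord_vec P c (chart_inv c x) \<xi>)"
proof -
  let ?p = "chart_inv c x"
  have p: "?p \<in> fst c" "snd c ?p = x" using chart_inv_in[OF assms(2)] chart_chart_inv[OF assms(2)] by auto
  have c: "c \<in> charts_at P ?p" using p assms(1) by (simp add: charts_at_def)
  show ?thesis unfolding chart_inv_def[of "tangent_chart P c"]
    by (rule inv_into_f_eq[OF tangent_chart_inj[OF assms(1)]])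
      (simp_all add: tangent_chart_simps p coord_vec_in_tangent_space[OF c] coord_vec_self[OF c])
qed

lemma tangent_transition:
  assumes "c \<in> atlas P" "d \<in> atlas P" "x \<in> snd c ` (fst c \<inter> fst d)"
  shows "transition (tangent_chart P c) (tangent_chart P d) (x, \<xi>)
    = (transition c d x, frechet_derivative (transition c d) (at x) \<xi>)"
proof -
  from assms(3) obtain p where p: "p \<in> fst c" "p \<in> fst d" "x = snd c p" by blast
  then have "d \<in> charts_at P p" using assms by (simp add: charts_at_def)
  then show ?thesis
    using p tangent_chart_inv[OF assms(1), of x \<xi>] chart_inv_chart[OF charts[OF assms(1)] p(1)]
    by (simp add: transition_def tangent_chart_simps coord_vec_def)
qed

text \<open>The transition maps are the tangent maps of the transition maps of \<open>P\<close>.\<close>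

lemma smooth_tangent_transition:
  assumes "c \<in> atlas P" "d \<in> atlas P"
  shows "smooth_on (snd c ` (fst c \<inter> fst d) \<times> UNIV) (transition (tangent_chart P c) (tangent_chart P d))"
proof -
  let ?W = "snd c ` (fst c \<inter> fst d)" and ?t = "transition c d"
  note W = open_overlap[OF assms] and t = smooth_transition[OF assms]
  have o: "open (?W \<times> (UNIV :: 'e set))" using W by (simp add: open_Times)
  have "smooth_on (?W \<times> (UNIV :: 'e set)) (\<lambda>z. ?t (fst z))"
    using smooth_on_compose[OF t smooth_on_bounded_linear[OF bounded_linear_fst o] _ o] by auto
  then have "smooth_on (?W \<times> UNIV) (\<lambda>z. (?t (fst z), (\<lambda>(x, h). frechet_derivative ?t (at x) h) z))"
    by (rule smooth_on_Pair[OF _ smooth_on_derivative[OF t W] o])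
  then show ?thesis
    by (rule smooth_on_cong[OF _ o]) (use tangent_transition[OF assms] in auto)
qed

lemma tangent_bundle_simps:
  "atlas (tangent_bundle P) = tangent_chart P ` atlas P"
  "points (tangent_bundle P) = {(p, v). p \<in> points P \<and> v \<in> tangent_space P p}"
proof -
  show "atlas (tangent_bundle P) = tangent_chart P ` atlas P" by (simp add: tangent_bundle_def)
  let ?\<B> = "{{w \<in> fst (tangent_chart P c). snd (tangent_chart P c) w \<in> S} | c S. c \<in> atlas P \<and> open S}"
  have "fst (tangent_chart P c) \<in> ?\<B>" if "c \<in> atlas P" for c
    using that by (intro CollectI exI[of _ c] exI[of _ UNIV]) simp
  then have "\<Union> ?\<B> = (\<Union>c\<in>atlas P. fst (tangent_chart P c))" by blast
  then have "points (tangent_bundle P) = (\<Union>c\<in>atlas P. fst (tangent_chart P c))"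
    by (simp add: tangent_bundle_def)
  then show "points (tangent_bundle P) = {(p, v). p \<in> points P \<and> v \<in> tangent_space P p}"
    unfolding cover[symmetric] by (auto simp: tangent_chart_def)
qed

lemma openin_tangent_vimage:
  assumes "c \<in> atlas P" "open S"
  shows "openin (mtop (tangent_bundle P)) {w \<in> fst (tangent_chart P c). snd (tangent_chart P c) w \<in> S}"
  unfolding tangent_bundle_def manifold.simps
  by (rule topology_generated_by_Basis) (use assms in blast)

text \<open>Induction on the generation of the topology. For a generating set this is the continuity of the
  transition map; an intersection is preserved because the chart is injective.\<close>

lemma open_tangent_image:
  assumes c: "c \<in> atlas P" and U: "openin (mtop (tangent_bundle P)) U"
  shows "open (snd (tangent_chart P c) ` (fst (tangent_chart P c) \<inter> U))"
proof -
  let ?f = "snd (tangent_chart P c)" and ?A = "fst (tangent_chart P c)"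
  from U have "generate_topology_on
      {{w \<in> fst (tangent_chart P c). snd (tangent_chart P c) w \<in> S} | c S. c \<in> atlas P \<and> open S} U"
    by (simp add: tangent_bundle_def openin_topology_generated_by_iff)
  then show ?thesis
  proof induction
    case Empty
    then show ?case by simp
  next
    case (Int a b)
    have "?f ` (?A \<inter> (a \<inter> b)) = ?f ` (?A \<inter> a) \<inter> ?f ` (?A \<inter> b)"
      using tangent_chart_inj[OF c] by (auto simp: inj_on_def)
    then show ?case using Int.IH by (simp add: open_Int)
  next
    case (UN K)
    have "?f ` (?A \<inter> \<Union> K) = (\<Union>k\<in>K. ?f ` (?A \<inter> k))" by auto
    then show ?case using UN.IH by auto
  next
    case (Basis s)
    then obtain d S where d: "d \<in> atlas P" "open S"
      and s: "s = {w \<in> fst (tangent_chart P d). snd (tangent_chart P d) w \<in> S}" by blast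
    let ?t = "transition (tangent_chart P c) (tangent_chart P d)"
    let ?W = "snd c ` (fst c \<inter> fst d) \<times> (UNIV :: 'e set)"
    have t: "?t (?f w) = snd (tangent_chart P d) w" if "w \<in> ?A" for w
      using that by (simp add: transition_def chart_inv_def inv_into_f_f[OF tangent_chart_inj[OF c]])
    have "?f ` (?A \<inter> s) = ?f ` (?A \<inter> fst (tangent_chart P d)) \<inter> ?t -` S"
      unfolding s using t by auto
    also have "\<dots> = ?W \<inter> ?t -` S" by (simp only: tangent_chart_image[OF c])
    finally show ?case
      using continuous_open_preimage[OF smooth_on_imp_continuous_on[OF
          smooth_tangent_transition[OF c d(1)]] _ d(2)] open_overlap[OF c d(1)]
      by (simp add: open_Times)
  qed
qed

lemma tangent_chart_on:
  assumes c: "c \<in> atlas P"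
  shows "chart_on (mtop (tangent_bundle P)) (tangent_chart P c)"
proof (rule chart_onI)
  show "openin (mtop (tangent_bundle P)) (fst (tangent_chart P c))"
    using openin_tangent_vimage[OF c open_UNIV] by simp
  show "open (snd (tangent_chart P c) ` fst (tangent_chart P c))"
    using chart_on_open(2)[OF charts[OF c]] by (simp add: tangent_chart_image_all[OF c] open_Times)
  show "open (snd (tangent_chart P c) ` U)"
    if "openin (mtop (tangent_bundle P)) U" "U \<subseteq> fst (tangent_chart P c)" for U
    using open_tangent_image[OF c that(1)] that(2) by (simp add: Int_absorb1)
qed (use tangent_chart_inj[OF c] openin_tangent_vimage[OF c] in auto)

text \<open>Hence everything that was said about tangent and cotangent spaces also holds for the
  tangent spaces of the tangent bundle.\<close>

lemma smooth_structure_tangent_bundle: "smooth_structure (tangent_bundle P)"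
proof
  show "chart_on (mtop (tangent_bundle P)) C" if "C \<in> atlas (tangent_bundle P)" for C
    using that tangent_chart_on by (auto simp: tangent_bundle_simps)
  show "compatible C D" if CD: "C \<in> atlas (tangent_bundle P)" "D \<in> atlas (tangent_bundle P)" for C D
  proof -
    obtain c d where "c \<in> atlas P" "d \<in> atlas P" "C = tangent_chart P c" "D = tangent_chart P d"
      using CD unfolding tangent_bundle_simps by blast
    then show ?thesis
      using smooth_tangent_transition[of c d] smooth_tangent_transition[of d c]
        tangent_chart_image[of c d] tangent_chart_image[of d c]
      by (simp add: compatible_def Int_commute)
  qed
  show "(\<Union>C\<in>atlas (tangent_bundle P). fst C) = points (tangent_bundle P)"
    unfolding tangent_bundle_simps cover[symmetric] by (auto simp: tangent_chart_def)
qed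

end

section \<open>The image of a vector field\<close>

definition local_rep :: "('a \<Rightarrow> 'a \<times> ('a, 'e) tvec) \<Rightarrow> ('a, 'e) chart \<Rightarrow> 'e \<Rightarrow> 'e" where
  "local_rep X c x = snd (X (chart_inv c x)) c"

lemma smooth_on_shear:
  fixes f :: "'e::euclidean_space \<Rightarrow> 'e"
  assumes "smooth_on U f" "open U"
  shows "smooth_on (U \<times> UNIV) (\<lambda>(x, \<xi>). (x, \<xi> + f x))"
proof -
  have o: "open (U \<times> (UNIV :: 'e set))" using assms(2) by (simp add: open_Times)
  have fst: "smooth_on (U \<times> (UNIV :: 'e set)) fst"
    and snd: "smooth_on (U \<times> (UNIV :: 'e set)) snd"
    by (rule smooth_on_bounded_linear[OF _ o], rule bounded_linear_fst bounded_linear_snd)+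
  have "smooth_on (U \<times> (UNIV :: 'e set)) (\<lambda>z. f (fst z))"
    using smooth_on_compose[OF assms(1) fst _ o] by auto
  from smooth_on_Pair[OF fst smooth_on_add[OF snd this o] o] show ?thesis
    by (simp add: case_prod_unfold)
qed

context smooth_structure
begin

interpretation TP: smooth_structure "tangent_bundle P"
  by (rule smooth_structure_tangent_bundle)

lemma vector_fieldD:
  assumes "vector_field P X" "p \<in> points P"
  shows "X p \<in> points (tangent_bundle P)" "X p = (p, snd (X p))" "snd (X p) \<in> tangent_space P p"
proof -
  have "continuous_map (mtop P) (mtop (tangent_bundle P)) X" and base: "fst (X p) = p"
    using assms by (auto simp: vector_field_def smooth_map_def)
  then show 1: "X p \<in> points (tangent_bundle P)" and 2: "X p = (p, snd (X p))"
    using assms(2) continuous_map_image_subset_topspace by (blast, metis prod.collapse)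
  then show "snd (X p) \<in> tangent_space P p" using base by (simp add: tangent_bundle_simps split_beta)
qed

lemma vector_field_in_tangent_chart:
  assumes "vector_field P X" "p \<in> points P"
  shows "X p \<in> fst (tangent_chart P c) \<longleftrightarrow> p \<in> fst c"
  using vector_fieldD[OF assms] tangent_chart_simps(1) by metis

lemma tangent_chart_vector_field:
  assumes "vector_field P X" "c \<in> atlas P" "p \<in> fst c"
  shows "snd (tangent_chart P c) (X p) = (snd c p, local_rep X c (snd c p))"
proof -
  have "p \<in> points P" using assms(2,3) cover by blast
  then have "snd (tangent_chart P c) (X p) = (snd c p, snd (X p) c)"
    using vector_fieldD(2)[OF assms(1)] tangent_chart_simps(2) by metis
  then show ?thesis by (simp add: local_rep_def chart_inv_chart[OF charts[OF assms(2)] assms(3)])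
qed

lemma smooth_vector_field:
  assumes X: "vector_field P X" and c: "c \<in> atlas P" and d: "d \<in> atlas P"
  shows "smooth_on (snd c ` (fst c \<inter> fst d)) (snd (tangent_chart P d) \<circ> X \<circ> chart_inv c)"
proof -
  have "smooth_on (snd c ` {p \<in> fst c. X p \<in> fst (tangent_chart P d)})
      (snd (tangent_chart P d) \<circ> X \<circ> chart_inv c)"
    using X c d by (simp add: vector_field_def smooth_map_def tangent_bundle_simps)
  moreover have "{p \<in> fst c. X p \<in> fst (tangent_chart P d)} = fst c \<inter> fst d"
    using vector_field_in_tangent_chart[OF X] c cover by blast
  ultimately show ?thesis by simp
qed

lemma smooth_local_rep:
  assumes X: "vector_field P X" and c: "c \<in> atlas P"
  shows "smooth_on (snd c ` fst c) (local_rep X c)"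
proof -
  note o = chart_on_open(2)[OF charts[OF c]]
  have "smooth_on (snd c ` fst c) (\<lambda>x. snd ((snd (tangent_chart P c) \<circ> X \<circ> chart_inv c) x))"
    using smooth_on_linear_comp[OF bounded_linear_snd smooth_vector_field[OF X c c]] o by simp
  then show ?thesis
  proof (rule smooth_on_cong[OF _ o])
    fix x assume x: "x \<in> snd c ` fst c"
    then show "snd ((snd (tangent_chart P c) \<circ> X \<circ> chart_inv c) x) = local_rep X c x"
      using tangent_chart_vector_field[OF X c chart_inv_in[OF x]] chart_chart_inv[OF x] by simp
  qed
qed

text \<open>In the coordinates \<open>(x, \<xi> - X x)\<close> the image of \<open>X\<close> is the slice \<open>\<xi> = 0\<close>.\<close>

lemma vector_field_submanifold:
  assumes X: "vector_field P X"
  shows "submanifold (tangent_bundle P) (X ` points P)"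
  unfolding submanifold_def
proof (intro conjI exI[of _ "DIM('e)"] ballI)
  show "X ` points P \<subseteq> points (tangent_bundle P)" using vector_fieldD(1)[OF X] by blast
  fix m assume "m \<in> X ` points P"
  then obtain p c where p: "m = X p" "p \<in> points P" "p \<in> fst c" and c: "c \<in> atlas P"
    using cover by blast
  let ?C = "tangent_chart P c" and ?V = "snd c ` fst c \<times> (UNIV :: 'e set)" and ?f = "local_rep X c"
  \<comment> \<open>\<open>\<phi>\<close> maps the graph of the local representative to \<open>S\<close>, and \<open>\<psi>\<close> is its inverse.\<close>
  define \<phi> where "\<phi> = (\<lambda>(x, \<xi>). (x, \<xi> + - ?f x))"
  define \<psi> where "\<psi> = (\<lambda>(x, \<xi>). (x, \<xi> + ?f x))"
  define S where "S = (\<lambda>x::'e. (x, 0::'e)) ` UNIV"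
  note o = chart_on_open(2)[OF charts[OF c]] and img = tangent_chart_image_all[OF c]
  have \<phi>V: "\<phi> ` ?V = ?V"
  proof (intro equalityI subsetI)
    fix z assume "z \<in> ?V"
    then show "z \<in> \<phi> ` ?V" by (intro image_eqI[of _ _ "\<psi> z"]) (auto simp: \<phi>_def \<psi>_def)
  qed (auto simp: \<phi>_def)
  have "smooth_on (snd c ` fst c) (\<lambda>x. - ?f x)"
    by (rule smooth_on_linear_comp[OF bounded_linear_minus[OF bounded_linear_ident] smooth_local_rep[OF X c] o])
  then have "smooth_on ?V \<phi>" "smooth_on ?V \<psi>"
    unfolding \<phi>_def \<psi>_def using smooth_on_shear o smooth_local_rep[OF X c] by blast+
  then have diffeo: "smooth_on (snd ?C ` fst ?C) \<phi>" "smooth_on (\<phi> ` snd ?C ` fst ?C) \<psi>"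
    "\<And>z. z \<in> snd ?C ` fst ?C \<Longrightarrow> \<psi> (\<phi> z) = z" "open (\<phi> ` snd ?C ` fst ?C)"
    unfolding img \<phi>V using o by (simp_all add: open_Times) (auto simp: \<phi>_def \<psi>_def)
  have "admissible_chart (tangent_bundle P) (fst ?C, \<phi> \<circ> snd ?C)"
    unfolding admissible_chart_def
  proof (intro conjI ballI)
    have C: "?C \<in> atlas (tangent_bundle P)" using c by (simp add: tangent_bundle_simps)
    show "chart_on (mtop (tangent_bundle P)) (fst ?C, \<phi> \<circ> snd ?C)"
      by (rule chart_on_diffeo[OF TP.charts[OF C] diffeo])
    show "compatible (fst ?C, \<phi> \<circ> snd ?C) D" if D: "D \<in> atlas (tangent_bundle P)" for D
      by (rule compatible_diffeo[OF TP.charts[OF C] TP.charts[OF D] TP.compatible[OF C D] diffeo])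
  qed
  moreover have "m \<in> fst ?C" using vector_field_in_tangent_chart[OF X p(2)] p by simp
  moreover have "linear (\<lambda>x::'e. (x, 0::'e))" by (rule linearI) auto
  then have "subspace S" "dim S = DIM('e)"
    unfolding S_def by (auto intro: linear_subspace_image simp: dim_image_eq inj_on_def)
  moreover have "(\<phi> \<circ> snd ?C) ` (fst ?C \<inter> X ` points P) = (\<phi> \<circ> snd ?C) ` fst ?C \<inter> S"
  proof -
    have "fst ?C \<inter> X ` points P = X ` fst c"
      using vector_field_in_tangent_chart[OF X] cover c by blast
    moreover have "(\<phi> \<circ> snd ?C) (X q) = (snd c q, 0)" if "q \<in> fst c" for q
      using tangent_chart_vector_field[OF X c that] by (simp add: \<phi>_def)
    ultimately have "(\<phi> \<circ> snd ?C) ` (fst ?C \<inter> X ` points P) = (\<lambda>q. (snd c q, 0)) ` fst c"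
      by (simp add: image_image cong: image_cong)
    also have "\<dots> = ?V \<inter> S" by (auto simp: S_def)
    also have "?V = (\<phi> \<circ> snd ?C) ` fst ?C" using \<phi>V img by (metis image_comp)
    finally show ?thesis .
  qed
  ultimately show "\<exists>C S. admissible_chart (tangent_bundle P) C \<and> m \<in> fst C \<and> subspace S \<and>
      dim S = DIM('e) \<and> snd C ` (fst C \<inter> X ` points P) = snd C ` fst C \<inter> S"
    by (intro exI[of _ "(fst ?C, \<phi> \<circ> snd ?C)"] exI[of _ S]) simp
qed

lemma tangent_chart_at:
  assumes "vector_field P X" "c \<in> charts_at P p"
  shows "tangent_chart P c \<in> charts_at (tangent_bundle P) (X p)"
proof -
  note c = charts_atD[OF assms(2)]
  then have "p \<in> points P" using cover by blast
  then show ?thesis using c vector_field_in_tangent_chart[OF assms(1)]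
    by (simp add: charts_at_def tangent_bundle_simps)
qed

text \<open>A curve in the image of \<open>X\<close> has coordinates \<open>(x t, X (x t))\<close> near \<open>t = 0\<close>; the chain rule gives
  the relation between the two components of its velocity.\<close>

lemma tangent_subspace_vector_field_subset:
  assumes X: "vector_field P X" and c: "c \<in> charts_at P p"
    and v: "v \<in> tangent_subspace (tangent_bundle P) (X ` points P) (X p)"
  shows "snd (v (tangent_chart P c))
    = frechet_derivative (local_rep X c) (at (snd c p)) (fst (v (tangent_chart P c)))"
proof -
  let ?C = "tangent_chart P c" and ?f = "local_rep X c"
  note C = TP.charts_atD[OF tangent_chart_at[OF X c]] and c' = charts_atD[OF c]
  obtain \<epsilon> \<gamma> where \<epsilon>: "\<epsilon> > 0"
    and smooth: "smooth_map (euclidean_manifold {-\<epsilon><..<\<epsilon>}) (tangent_bundle P) \<gamma>"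
    and sub: "\<gamma> ` {-\<epsilon><..<\<epsilon>} \<subseteq> X ` points P" and \<gamma>0: "\<gamma> (0::real) = X p"
    and deriv: "((snd ?C \<circ> \<gamma>) has_vector_derivative v ?C) (at 0)"
    using v tangent_chart_at[OF X c] unfolding tangent_subspace_def by blast
  \<comment> \<open>The times at which the curve is in the domain of the chart.\<close>
  define J where "J = {t \<in> {-\<epsilon><..<\<epsilon>}. \<gamma> t \<in> fst ?C}"
  have "continuous_map (top_of_set {-\<epsilon><..<\<epsilon>}) (mtop (tangent_bundle P)) \<gamma>"
    using smooth by (simp add: smooth_map_def euclidean_manifold_def)
  from openin_continuous_map_preimage[OF this chart_on_open(1)[OF C(3)]]
  have "open J" unfolding J_def by (simp add: openin_open_eq)
  have "0 \<in> J" using \<epsilon> \<gamma>0 C(2) by (simp add: J_def)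
  define y where "y = snd ?C \<circ> \<gamma>"
  have graph: "\<exists>q\<in>fst c. y t = (snd c q, ?f (snd c q))" if t: "t \<in> J" for t
  proof -
    obtain q where q: "q \<in> points P" "\<gamma> t = X q" using t sub unfolding J_def by blast
    then have "q \<in> fst c" using t vector_field_in_tangent_chart[OF X q(1)] by (simp add: J_def)
    then show ?thesis using tangent_chart_vector_field[OF X c'(1)] q by (auto simp: y_def)
  qed
  have y0: "fst (y 0) = snd c p"
    using \<gamma>0 tangent_chart_vector_field[OF X c'(1,2)] by (simp add: y_def)
  have y': "(y has_derivative (\<lambda>r. r *\<^sub>R v ?C)) (at 0)"
    using deriv by (simp add: y_def has_vector_derivative_def)
  have "(?f has_derivative frechet_derivative ?f (at (snd c p))) (at (fst (y 0)))"
    unfolding y0 using smooth_onD[OF smooth_local_rep[OF X c'(1)]] c'(2) by blast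
  from has_derivative_compose[OF has_derivative_fst[OF y'] this]
  have "((\<lambda>t. ?f (fst (y t))) has_derivative
      (\<lambda>r. frechet_derivative ?f (at (snd c p)) (fst (r *\<^sub>R v ?C)))) (at 0)" .
  then have "((\<lambda>t. snd (y t)) has_derivative
      (\<lambda>r. frechet_derivative ?f (at (snd c p)) (fst (r *\<^sub>R v ?C)))) (at 0)"
    by (rule has_derivative_transform_within_open[OF _ \<open>open J\<close> \<open>0 \<in> J\<close>]) (use graph in fastforce)
  from fun_cong[OF has_derivative_unique[OF has_derivative_snd[OF y'] this], of 1]
  show ?thesis by simp
qed

text \<open>The velocity \<open>(x, D X x)\<close> is attained by the curve that \<open>X\<close> makes out of a straight line in
  the chart.\<close>

lemma tangent_subspace_vector_field_supset:
  assumes X: "vector_field P X" and c: "c \<in> charts_at P p"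
  shows "coord_vec (tangent_bundle P) (tangent_chart P c) (X p)
      (x, frechet_derivative (local_rep X c) (at (snd c p)) x)
    \<in> tangent_subspace (tangent_bundle P) (X ` points P) (X p)"
proof -
  let ?C = "tangent_chart P c" and ?f = "local_rep X c"
  let ?A = "frechet_derivative ?f (at (snd c p))"
  let ?v = "coord_vec (tangent_bundle P) ?C (X p) (x, ?A x)"
  note CX = tangent_chart_at[OF X c]
  note C = TP.charts_atD[OF CX] and c' = charts_atD[OF c]
  \<comment> \<open>The straight line \<open>l\<close> in the chart, the curve \<open>q\<close> in \<open>P\<close> that it represents, and the image
    \<open>\<gamma>\<close> of \<open>q\<close> under \<open>X\<close>.\<close>
  define l where "l t = snd c p + t *\<^sub>R x" for t :: real
  have l: "continuous_on UNIV l" unfolding l_def by (intro continuous_intros)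
  have "open (l -` (snd c ` fst c))"
    by (rule open_vimage[OF chart_on_open(2)[OF c'(3)] l])
  moreover have "0 \<in> l -` (snd c ` fst c)" using c'(2) by (simp add: l_def)
  ultimately obtain \<epsilon> where "\<epsilon> > 0" "ball 0 \<epsilon> \<subseteq> l -` (snd c ` fst c)" by (rule openE)
  then have \<epsilon>: "\<epsilon> > 0" "{-\<epsilon><..<\<epsilon>} \<subseteq> l -` (snd c ` fst c)"
    by (simp_all add: ball_eq_greaterThanLessThan)
  let ?I = "{-\<epsilon><..<\<epsilon>}"
  have lI: "l t \<in> snd c ` fst c" if "t \<in> ?I" for t using that \<epsilon>(2) by blast
  define q where "q t = chart_inv c (l t)" for t
  have q: "q t \<in> fst c" "snd c (q t) = l t" if "t \<in> ?I" for t
    using chart_inv_in[OF lI[OF that]] chart_chart_inv[OF lI[OF that]] by (simp_all add: q_def)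
  have q_in: "{t \<in> ?I. q t \<in> U} = ?I \<inter> l -` (snd c ` (fst c \<inter> U))" for U
  proof (intro equalityI subsetI)
    fix t assume t: "t \<in> ?I \<inter> l -` (snd c ` (fst c \<inter> U))"
    then obtain r where "r \<in> fst c \<inter> U" "l t = snd c r" by auto
    then show "t \<in> {t \<in> ?I. q t \<in> U}" using t chart_inv_chart[OF c'(3)] by (simp add: q_def)
  qed (use q in force)
  have q_points: "q t \<in> points P" if "t \<in> ?I" for t using q(1)[OF that] c'(1) cover by blast
  define \<gamma> where "\<gamma> = X \<circ> q"
  have "continuous_map (top_of_set ?I) (mtop P) q"
    unfolding continuous_map
  proof (intro conjI allI impI)
    show "q ` topspace (top_of_set ?I) \<subseteq> points P" using q_points by auto
    fix U assume "openin (mtop P) U"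
    then have "open (snd c ` (fst c \<inter> U))" by (rule chart_open_image[OF c'(3)])
    then have "open (?I \<inter> l -` (snd c ` (fst c \<inter> U)))"
      by (intro open_Int open_vimage[OF _ l] open_greaterThanLessThan)
    then show "openin (top_of_set ?I) {t \<in> topspace (top_of_set ?I). q t \<in> U}"
      using q_in[of U] by (simp add: openin_open_eq)
  qed
  then have cont: "continuous_map (top_of_set ?I) (mtop (tangent_bundle P)) \<gamma>"
    unfolding \<gamma>_def using X continuous_map_compose
    by (auto simp: vector_field_def smooth_map_def)
  have "smooth_map (euclidean_manifold ?I) (tangent_bundle P) \<gamma>"
    unfolding smooth_map_def
  proof (intro conjI ballI)
    show "continuous_map (mtop (euclidean_manifold ?I)) (mtop (tangent_bundle P)) \<gamma>"
      using cont by (simp add: euclidean_manifold_def)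
    fix i D assume "i \<in> atlas (euclidean_manifold ?I)" and "D \<in> atlas (tangent_bundle P)"
    then obtain d where i: "i = (?I, \<lambda>t. t)" and d: "d \<in> atlas P" "D = tangent_chart P d"
      by (auto simp only: euclidean_manifold_def tangent_bundle_simps manifold.simps)
    let ?K = "{t \<in> ?I. q t \<in> fst d}"
    have K: "?K = ?I \<inter> l -` (snd c ` (fst c \<inter> fst d))" by (rule q_in)
    have oK: "open ?K" unfolding K
      by (intro open_Int open_vimage[OF open_overlap[OF c'(1) d(1)] l] open_greaterThanLessThan)
    have "smooth_on ?K l"
      unfolding l_def using oK
      by (intro smooth_on_add smooth_on_const smooth_on_bounded_linear bounded_linear_scaleR_left)
    then have "smooth_on ?K (\<lambda>t. (snd D \<circ> X \<circ> chart_inv c) (l t))"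
      unfolding d(2) using smooth_on_compose[OF smooth_vector_field[OF X c'(1) d(1)] _ _ oK, of l] K
      by blast
    then have "smooth_on ?K (snd D \<circ> \<gamma> \<circ> chart_inv i)"
    proof (rule smooth_on_cong[OF _ oK])
      fix t assume "t \<in> ?K"
      then have "chart_inv i t = t" unfolding i chart_inv_def by (simp add: inv_into_f_eq)
      then show "(snd D \<circ> X \<circ> chart_inv c) (l t) = (snd D \<circ> \<gamma> \<circ> chart_inv i) t"
        by (simp add: \<gamma>_def q_def)
    qed
    moreover have "snd i ` {t \<in> fst i. \<gamma> t \<in> fst D} = ?K"
      using vector_field_in_tangent_chart[OF X q_points, of _ d] by (auto simp: i d(2) \<gamma>_def)
    ultimately show "smooth_on (snd i ` {t \<in> fst i. \<gamma> t \<in> fst D}) (snd D \<circ> \<gamma> \<circ> chart_inv i)" by simp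
  qed
  moreover have "\<gamma> ` ?I \<subseteq> X ` points P" using q_points by (auto simp: \<gamma>_def)
  moreover have \<gamma>0: "\<gamma> 0 = X p" using chart_inv_chart[OF c'(3,2)] by (simp add: \<gamma>_def q_def l_def)
  moreover have "((snd D \<circ> \<gamma>) has_vector_derivative ?v D) (at 0)"
    if D: "D \<in> charts_at (tangent_bundle P) (X p)" for D
  proof -
    have "l 0 = snd c p" by (simp add: l_def)
    then have "(?f has_derivative ?A) (at (l 0))"
      using smooth_onD[OF smooth_local_rep[OF X c'(1)]] c'(2) by auto
    moreover have "(l has_derivative (\<lambda>r. r *\<^sub>R x)) (at 0)"
      unfolding l_def by (auto intro!: derivative_eq_intros)
    ultimately have "((\<lambda>t. (l t, ?f (l t))) has_derivative (\<lambda>r. (r *\<^sub>R x, ?A (r *\<^sub>R x)))) (at 0)"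
      using has_derivative_compose has_derivative_Pair by blast
    moreover have "?A (r *\<^sub>R x) = r *\<^sub>R ?A x" for r
      using \<open>(?f has_derivative ?A) (at (l 0))\<close> has_derivative_linear linear_scale by blast
    moreover have C\<gamma>: "snd ?C (\<gamma> t) = (l t, ?f (l t))" if "t \<in> ?I" for t
      using tangent_chart_vector_field[OF X c'(1) q(1)[OF that]] q(2)[OF that] by (simp add: \<gamma>_def)
    moreover have "(transition ?C D has_derivative TP.dtrans ?C D (X p)) (at (l 0, ?f (l 0)))"
      using TP.has_derivative_transition[OF CX D] C\<gamma>[of 0] \<gamma>0 \<epsilon>(1) by simp
    ultimately have "((\<lambda>t. transition ?C D (l t, ?f (l t))) has_derivative
        (\<lambda>r. TP.dtrans ?C D (X p) (r *\<^sub>R (x, ?A x)))) (at 0)"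
      using has_derivative_compose[of "\<lambda>t. (l t, ?f (l t))" "\<lambda>r. r *\<^sub>R (x, ?A x)" 0 UNIV] by simp
    then have "((snd D \<circ> \<gamma>) has_derivative (\<lambda>r. TP.dtrans ?C D (X p) (r *\<^sub>R (x, ?A x)))) (at 0)"
    proof (rule has_derivative_transform_within_open[of _ _ _ _ ?I])
      fix t assume t: "t \<in> ?I"
      then have "\<gamma> t \<in> fst ?C"
        using q(1) vector_field_in_tangent_chart[OF X q_points] by (simp add: \<gamma>_def)
      from transition_chart[OF C(3) this, of D]
      show "transition ?C D (l t, ?f (l t)) = (snd D \<circ> \<gamma>) t" using C\<gamma>[OF t] by simp
    qed (use \<epsilon>(1) in auto)
    moreover have "TP.dtrans ?C D (X p) (r *\<^sub>R (x, ?A x)) = r *\<^sub>R ?v D" for r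
      using D by (simp only: coord_vec_def if_True linear_scale[OF TP.linear_dtrans[OF CX D]])
    ultimately show ?thesis by (simp add: has_vector_derivative_def)
  qed
  ultimately show ?thesis
    using TP.coord_vec_in_tangent_space[OF CX] \<epsilon>(1) unfolding tangent_subspace_def by blast
qed

lemma tangent_subspace_vector_field:
  assumes X: "vector_field P X" and c: "c \<in> charts_at P p"
  shows "tangent_subspace (tangent_bundle P) (X ` points P) (X p)
    = coord_vec (tangent_bundle P) (tangent_chart P c) (X p) `
        range (\<lambda>x. (x, frechet_derivative (local_rep X c) (at (snd c p)) x))" (is "?T = ?R")
proof (intro equalityI subsetI)
  let ?C = "tangent_chart P c"
  fix v assume v: "v \<in> ?T"
  then have "v = coord_vec (tangent_bundle P) ?C (X p) (v ?C)"
    using TP.coord_vec_of_coords[OF _ tangent_chart_at[OF X c]] by (simp add: tangent_subspace_def)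
  moreover have "v ?C = (fst (v ?C), frechet_derivative (local_rep X c) (at (snd c p)) (fst (v ?C)))"
    using tangent_subspace_vector_field_subset[OF X c v] by (simp add: prod_eq_iff)
  then have "v ?C \<in> range (\<lambda>x. (x, frechet_derivative (local_rep X c) (at (snd c p)) x))"
    by (rule range_eqI)
  ultimately show "v \<in> ?R" by (rule image_eqI)
qed (use tangent_subspace_vector_field_supset[OF X c] in auto)

end

section \<open>The Lagrangian condition for a graph\<close>

text \<open>The linear algebra behind the theorem. Here \<open>F\<close> has the form that the sharp map of a tangent lift
  takes in coordinates and \<open>T\<close> is the graph of \<open>A\<close>, whose annihilator consists of the pairs
  \<open>(- A\<^sup>* b, b)\<close>. The image of such a pair under \<open>F\<close> is \<open>(- B b, B A\<^sup>* b - L b)\<close>, which lies on the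
  graph if and only if \<open>L b = A B b + B A\<^sup>* b\<close>. So this equation expresses that \<open>F\<close> maps the
  annihilator into \<open>T\<close>. The equation also gives the reverse inclusion: if \<open>F (a, b)\<close> lies on the
  graph, then \<open>B a = - B A\<^sup>* b\<close>, so \<open>F\<close> does not distinguish \<open>(a, b)\<close> from \<open>(- A\<^sup>* b, b)\<close>.\<close>

lemma lagrangian_graph_iff:
  fixes A B L :: "'e::euclidean_space \<Rightarrow> 'e"
  assumes A: "linear A" and B: "linear B"
  defines "F \<equiv> \<lambda>(a, b). (- B b, - B a - L b)" and "T \<equiv> range (\<lambda>x. (x, A x))"
  shows "F ` {z. \<forall>t\<in>T. t \<bullet> z = 0} = range F \<inter> T \<longleftrightarrow> (\<forall>b. L b = A (B b) + B (adjoint A b))"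
proof -
  have ann: "(\<forall>t\<in>T. t \<bullet> (a, b) = 0) \<longleftrightarrow> a = - adjoint A b" for a b
  proof
    assume "\<forall>t\<in>T. t \<bullet> (a, b) = 0"
    then have "x \<bullet> a + A x \<bullet> b = 0" for x by (simp add: T_def)
    then have "x \<bullet> a = x \<bullet> - adjoint A b" for x
      using adjoint_works[OF A, of x b] by (metis add_eq_0_iff2 inner_minus_right)
    then show "a = - adjoint A b" using vector_eq_ldot by blast
  qed (simp add: T_def adjoint_works[OF A])
  have T: "(x, y) \<in> T \<longleftrightarrow> y = A x" for x y by (auto simp: T_def)
  have image: "F ` {z. \<forall>t\<in>T. t \<bullet> z = 0} = range (\<lambda>b. F (- adjoint A b, b))"
    using ann by (auto simp: image_iff)
  show ?thesis
  proof
    assume eq: "F ` {z. \<forall>t\<in>T. t \<bullet> z = 0} = range F \<inter> T"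
    show "\<forall>b. L b = A (B b) + B (adjoint A b)"
    proof
      fix b
      have "F (- adjoint A b, b) \<in> T" using eq image by blast
      then show "L b = A (B b) + B (adjoint A b)"
        by (simp add: F_def T linear_neg[OF A] linear_neg[OF B] algebra_simps)
    qed
  next
    assume L: "\<forall>b. L b = A (B b) + B (adjoint A b)"
    have "F (- adjoint A b, b) \<in> T" for b
      using L by (simp add: F_def T linear_neg[OF A] linear_neg[OF B])
    moreover have "F (a, b) = F (- adjoint A b, b)" if "F (a, b) \<in> T" for a b
      using that L by (simp add: F_def T linear_neg[OF A] linear_neg[OF B])
    ultimately show "F ` {z. \<forall>t\<in>T. t \<bullet> z = 0} = range F \<inter> T"
      unfolding image
    proof (intro equalityI subsetI; elim IntE rangeE)
      fix y z assume "\<And>b. F (- adjoint A b, b) \<in> T"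
        and "\<And>a b. F (a, b) \<in> T \<Longrightarrow> F (a, b) = F (- adjoint A b, b)"
        and "y \<in> T" "y = F z"
      then have "y = F (- adjoint A (snd z), snd z)" by (metis prod.collapse)
      then show "y \<in> range (\<lambda>b. F (- adjoint A b, b))" by (rule range_eqI)
    qed auto
  qed
qed

text \<open>The linear map with the matrix \<open>B\<close>, written with sums over the index set \<open>Basis\<close>.\<close>

definition coeff_map :: "('e \<Rightarrow> 'e \<Rightarrow> real) \<Rightarrow> 'e::euclidean_space \<Rightarrow> 'e" where
  "coeff_map B \<beta> = (\<Sum>i\<in>Basis. \<Sum>j\<in>Basis. (B i j * (\<beta> \<bullet> j)) *\<^sub>R i)"

lemma linear_coeff_map: "linear (coeff_map B)"
  by (rule linearI)
    (simp_all add: coeff_map_def inner_add_left algebra_simps sum.distrib scaleR_sum_right)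

lemma inner_coeff_map:
  "\<alpha> \<bullet> coeff_map B \<beta> = (\<Sum>i\<in>Basis. \<Sum>j\<in>Basis. B i j * ((\<alpha> \<bullet> i) * (\<beta> \<bullet> j)))"
  by (simp add: coeff_map_def inner_sum_right algebra_simps)

lemma Basis_coeff_map:
  assumes "i \<in> Basis" "j \<in> Basis"
  shows "i \<bullet> coeff_map B j = B i j"
proof -
  have "i \<bullet> coeff_map B j = (\<Sum>k\<in>Basis. \<Sum>l\<in>Basis. if l = j then if k = i then B k l else 0 else 0)"
    unfolding inner_coeff_map using assms by (intro sum.cong) (auto simp: inner_Basis)
  then show ?thesis using assms by simp
qed

lemma coeff_map_antisym:
  assumes "\<And>i j. i \<in> Basis \<Longrightarrow> j \<in> Basis \<Longrightarrow> B i j = - B j i"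
  shows "\<alpha> \<bullet> coeff_map B \<beta> = - (\<beta> \<bullet> coeff_map B \<alpha>)"
proof -
  have "\<alpha> \<bullet> coeff_map B \<beta> = (\<Sum>j\<in>Basis. \<Sum>i\<in>Basis. B i j * ((\<alpha> \<bullet> i) * (\<beta> \<bullet> j)))"
    unfolding inner_coeff_map by (rule sum.swap)
  also have "\<dots> = (\<Sum>j\<in>Basis. \<Sum>i\<in>Basis. - (B j i * ((\<beta> \<bullet> j) * (\<alpha> \<bullet> i))))"
    by (intro sum.cong refl) (subst assms, auto)
  finally show ?thesis by (simp add: inner_coeff_map sum_negf)
qed

lemma sum_Basis_bilinear:
  fixes Q :: "'e::euclidean_space \<Rightarrow> 'e"
  assumes "linear Q"
  shows "(\<Sum>i\<in>Basis. \<Sum>j\<in>Basis. (i \<bullet> Q j) * ((\<alpha> \<bullet> i) * (\<beta> \<bullet> j))) = \<alpha> \<bullet> Q \<beta>"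
proof -
  have "\<alpha> \<bullet> Q \<beta> = (\<Sum>i\<in>Basis. (\<alpha> \<bullet> i) * (Q \<beta> \<bullet> i))" by (rule euclidean_inner)
  also have "\<dots> = (\<Sum>i\<in>Basis. \<Sum>j\<in>Basis. (i \<bullet> Q j) * ((\<alpha> \<bullet> i) * (\<beta> \<bullet> j)))"
    by (subst linear_basis_expansion[OF assms])
      (simp add: inner_sum_left inner_sum_right sum_distrib_left inner_commute mult_ac)
  finally show ?thesis ..
qed

section \<open>The tangent lift and the Lie derivative in coordinates\<close>

context smooth_structure
begin

interpretation TP: smooth_structure "tangent_bundle P"
  by (rule smooth_structure_tangent_bundle)

text \<open>The matrix of \<open>\<Lambda>\<close> at \<open>p\<close> and its derivative in the direction \<open>\<xi>\<close>, as linear maps. The chart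
  \<open>chart_at P p\<close> is the one in which both the Lie derivative and the tangent lift are computed, so
  that comparing the two involves no change of coordinates.\<close>

definition bivec_map :: "('a \<Rightarrow> ('a, 'e) bivec) \<Rightarrow> 'a \<Rightarrow> 'e \<Rightarrow> 'e" where
  "bivec_map \<Lambda> p = coeff_map (\<lambda>i j. bivec_coeff P (chart_at P p) \<Lambda> i j p)"

definition bivec_deriv :: "('a \<Rightarrow> ('a, 'e) bivec) \<Rightarrow> 'a \<Rightarrow> 'e \<Rightarrow> 'e \<Rightarrow> 'e" where
  "bivec_deriv \<Lambda> p \<xi> = coeff_map (\<lambda>i j. \<Sum>k\<in>Basis.
     partial (chart_at P p) k (bivec_coeff P (chart_at P p) \<Lambda> i j) p * (\<xi> \<bullet> k))"

lemma bivec_coeff_antisym: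
  assumes "bivector_field P \<Lambda>" "c \<in> atlas P" "q \<in> fst c"
  shows "bivec_coeff P c \<Lambda> i j q = - bivec_coeff P c \<Lambda> j i q"
proof -
  have "q \<in> points P" "c \<in> charts_at P q" using assms(2,3) cover by (auto simp: charts_at_def)
  then show ?thesis
    using assms(1) coord_covec_in_cotangent_space
    unfolding bivec_coeff_def bivector_field_def bivector_at_def by blast
qed

lemma partial_bivec_coeff_antisym:
  assumes \<Lambda>: "bivector_field P \<Lambda>" and c: "c \<in> charts_at P p" and ij: "i \<in> Basis" "j \<in> Basis"
  shows "partial c k (bivec_coeff P c \<Lambda> i j) p = - partial c k (bivec_coeff P c \<Lambda> j i) p"
proof -
  let ?g = "\<lambda>i j. bivec_coeff P c \<Lambda> i j \<circ> chart_inv c"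
  note c' = charts_atD[OF c]
  have "smooth_on (snd c ` fst c) (?g j i)" using \<Lambda> c'(1) ij by (simp add: bivector_field_def)
  then have "(?g j i has_derivative frechet_derivative (?g j i) (at (snd c p))) (at (snd c p))"
    using smooth_onD c'(2) by blast
  then have "(?g i j has_derivative (\<lambda>h. - frechet_derivative (?g j i) (at (snd c p)) h)) (at (snd c p))"
  proof (rule has_derivative_transform_within_open[OF has_derivative_minus chart_on_open(2)[OF c'(3)]])
    fix x assume "x \<in> snd c ` fst c"
    from bivec_coeff_antisym[OF \<Lambda> c'(1) chart_inv_in[OF this], of i j]
    show "- ?g j i x = ?g i j x" by simp
  qed (use c'(2) in blast)
  from fun_cong[OF frechet_derivative_at[OF this], of k] show ?thesis by (simp add: partial_def)
qed

lemma bivec_map_antisym: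
  assumes "bivector_field P \<Lambda>" "p \<in> points P"
  shows "\<alpha> \<bullet> bivec_map \<Lambda> p \<beta> = - (\<beta> \<bullet> bivec_map \<Lambda> p \<alpha>)"
    and "\<alpha> \<bullet> bivec_deriv \<Lambda> p \<xi> \<beta> = - (\<beta> \<bullet> bivec_deriv \<Lambda> p \<xi> \<alpha>)"
proof -
  note c = chart_at_charts_at[OF assms(2)]
  show "\<alpha> \<bullet> bivec_map \<Lambda> p \<beta> = - (\<beta> \<bullet> bivec_map \<Lambda> p \<alpha>)"
    unfolding bivec_map_def
    by (rule coeff_map_antisym, rule bivec_coeff_antisym[OF assms(1) charts_atD(1,2)[OF c]])
  show "\<alpha> \<bullet> bivec_deriv \<Lambda> p \<xi> \<beta> = - (\<beta> \<bullet> bivec_deriv \<Lambda> p \<xi> \<alpha>)"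
    unfolding bivec_deriv_def
    by (rule coeff_map_antisym, subst partial_bivec_coeff_antisym[OF assms(1) c]) (simp_all add: sum_negf)
qed

text \<open>With \<open>B\<close> the matrix of \<open>\<Lambda>\<close> and \<open>L\<close> its derivative along the velocity, the sharp map of the tangent
  lift is \<open>(a, b) \<mapsto> (- B b, - B a - L b)\<close>, the map \<open>F\<close> of the lemma on graphs. The signs come from the
  antisymmetry of \<open>B\<close> and \<open>L\<close>, and that of \<open>L\<close> also absorbs the factor \<open>1 / 2\<close>.\<close>

lemma tangent_lift_coord_covec:
  assumes \<Lambda>: "bivector_field P \<Lambda>" and p: "p \<in> points P" and v: "v \<in> tangent_space P p"
  defines "C \<equiv> tangent_chart P (chart_at P p)" and "\<xi> \<equiv> v (chart_at P p)"
  shows "tangent_lift P \<Lambda> (p, v) (coord_covec (tangent_bundle P) C (p, v) (a, b))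
      (coord_covec (tangent_bundle P) C (p, v) \<beta>)
    = (- bivec_map \<Lambda> p b, - bivec_map \<Lambda> p a - bivec_deriv \<Lambda> p \<xi> b) \<bullet> \<beta>"
proof -
  obtain a' b' where \<beta>: "\<beta> = (a', b')" by fastforce
  have "C \<in> charts_at (tangent_bundle P) (p, v)"
    using charts_atD[OF chart_at_charts_at[OF p]] v
    by (simp add: C_def charts_at_def tangent_bundle_simps tangent_chart_simps)
  note pairing = TP.coord_covec_coord_vec[OF this]
  let ?B = "\<lambda>i j. bivec_coeff P (chart_at P p) \<Lambda> i j p"
  let ?D = "\<lambda>i j. \<Sum>k\<in>Basis. partial (chart_at P p) k (bivec_coeff P (chart_at P p) \<Lambda> i j) p * (\<xi> \<bullet> k)"
  have "tangent_lift P \<Lambda> (p, v) (coord_covec (tangent_bundle P) C (p, v) (a, b))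
      (coord_covec (tangent_bundle P) C (p, v) \<beta>)
    = (\<Sum>i\<in>Basis. \<Sum>j\<in>Basis. ?B i j * ((a \<bullet> i) * (b' \<bullet> j) - (a' \<bullet> i) * (b \<bullet> j)))
      + 1 / 2 * (\<Sum>i\<in>Basis. \<Sum>j\<in>Basis. ?D i j * ((b \<bullet> i) * (b' \<bullet> j) - (b' \<bullet> i) * (b \<bullet> j)))"
    unfolding \<beta> tangent_lift_def Let_def wedge_def fst_conv snd_conv C_def[symmetric] \<xi>_def[symmetric] pairing
    by (simp add: sum_distrib_left sum_distrib_right inner_commute mult_ac)
  also have "\<dots> = a \<bullet> bivec_map \<Lambda> p b' - a' \<bullet> bivec_map \<Lambda> p b
      + 1 / 2 * (b \<bullet> bivec_deriv \<Lambda> p \<xi> b' - b' \<bullet> bivec_deriv \<Lambda> p \<xi> b)"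
    unfolding bivec_map_def bivec_deriv_def inner_coeff_map
    by (simp only: right_diff_distrib sum_subtractf)
  also have "\<dots> = (- bivec_map \<Lambda> p b, - bivec_map \<Lambda> p a - bivec_deriv \<Lambda> p \<xi> b) \<bullet> \<beta>"
    using bivec_map_antisym(1)[OF \<Lambda> p, of a b'] bivec_map_antisym(2)[OF \<Lambda> p, of b \<xi> b']
    by (simp add: \<beta> inner_commute inner_diff_left inner_diff_right)
  finally show ?thesis .
qed

text \<open>The three terms of the coefficient are the entries of three matrices: those of \<open>L\<close> by definition,
  and those of \<open>A B\<close> and \<open>B A\<^sup>*\<close> by expanding the arguments of \<open>A\<close> and of \<open>B\<close> in the basis.\<close>

lemma lie_coeff_eq:
  assumes X: "vector_field P X" and p: "p \<in> points P" and ij: "i \<in> Basis" "j \<in> Basis"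
  defines "c \<equiv> chart_at P p"
  defines "A \<equiv> frechet_derivative (local_rep X c) (at (snd c p))"
  shows "lie_coeff P c X \<Lambda> i j p = i \<bullet> (bivec_deriv \<Lambda> p (snd (X p) c) j
      - A (bivec_map \<Lambda> p j) - bivec_map \<Lambda> p (adjoint A j))"
proof -
  have c: "c \<in> charts_at P p" unfolding c_def by (rule chart_at_charts_at[OF p])
  note c' = charts_atD[OF c]
  have dX: "(local_rep X c has_derivative A) (at (snd c p))"
    unfolding A_def using smooth_onD[OF smooth_local_rep[OF X c'(1)]] c'(2) by blast
  then have A: "linear A" by (rule has_derivative_linear)
  have partial: "partial c k (\<lambda>q. snd (X q) c \<bullet> l) p = A k \<bullet> l" for k l
  proof -
    have "((\<lambda>x. local_rep X c x \<bullet> l) has_derivative (\<lambda>h. A h \<bullet> l)) (at (snd c p))"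
      using dX by (rule has_derivative_inner_left)
    from fun_cong[OF frechet_derivative_at[OF this], of k] show ?thesis
      by (simp add: partial_def local_rep_def comp_def)
  qed
  have "A (bivec_map \<Lambda> p j) \<bullet> i = (\<Sum>k\<in>Basis. (bivec_map \<Lambda> p j \<bullet> k) * (A k \<bullet> i))"
    by (subst linear_basis_expansion[OF A]) (simp add: inner_sum_left)
  then have 1: "i \<bullet> A (bivec_map \<Lambda> p j) = (\<Sum>k\<in>Basis. bivec_coeff P c \<Lambda> k j p * (A k \<bullet> i))"
    using ij by (simp add: inner_commute bivec_map_def Basis_coeff_map c_def)
  have "bivec_map \<Lambda> p (adjoint A j) \<bullet> i = (\<Sum>k\<in>Basis. (adjoint A j \<bullet> k) * (bivec_map \<Lambda> p k \<bullet> i))"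
    by (subst linear_basis_expansion[of "bivec_map \<Lambda> p"])
      (simp_all add: inner_sum_left bivec_map_def linear_coeff_map)
  then have 2: "i \<bullet> bivec_map \<Lambda> p (adjoint A j) = (\<Sum>k\<in>Basis. bivec_coeff P c \<Lambda> i k p * (A k \<bullet> j))"
    using ij adjoint_works[OF A]
    by (simp add: inner_commute bivec_map_def Basis_coeff_map c_def mult.commute)
  show ?thesis
    unfolding lie_coeff_def Let_def partial inner_diff_right 1 2 bivec_deriv_def
    using ij by (simp add: Basis_coeff_map sum_subtractf c_def[symmetric] mult.commute)
qed

text \<open>The matrix \<open>Q = L - A B - B A\<^sup>*\<close> is antisymmetric, because \<open>B\<close> and \<open>L\<close> are and the last two
  terms are exchanged by transposition up to sign. Hence the two halves of the alternating sum agree.\<close>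

lemma lie_derivative_coord_covec:
  assumes \<Lambda>: "bivector_field P \<Lambda>" and X: "vector_field P X" and p: "p \<in> points P"
  defines "c \<equiv> chart_at P p"
  defines "A \<equiv> frechet_derivative (local_rep X c) (at (snd c p))"
  shows "lie_derivative P X \<Lambda> p (coord_covec P c p \<alpha>) (coord_covec P c p \<beta>)
    = \<alpha> \<bullet> (bivec_deriv \<Lambda> p (snd (X p) c) \<beta> - A (bivec_map \<Lambda> p \<beta>) - bivec_map \<Lambda> p (adjoint A \<beta>))"
proof -
  have c: "c \<in> charts_at P p" unfolding c_def by (rule chart_at_charts_at[OF p])
  note c' = charts_atD[OF c]
  have "(local_rep X c has_derivative A) (at (snd c p))"
    unfolding A_def using smooth_onD[OF smooth_local_rep[OF X c'(1)]] c'(2) by blast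
  then have A: "linear A" by (rule has_derivative_linear)
  define Q where "Q \<beta> = bivec_deriv \<Lambda> p (snd (X p) c) \<beta> - A (bivec_map \<Lambda> p \<beta>)
    - bivec_map \<Lambda> p (adjoint A \<beta>)" for \<beta>
  have "linear Q"
    unfolding Q_def bivec_deriv_def bivec_map_def
    using linear_compose[OF linear_coeff_map A] linear_compose[OF adjoint_linear[OF A] linear_coeff_map]
    by (intro linear_compose_sub linear_coeff_map) (simp_all add: comp_def)
  have anti: "\<beta> \<bullet> Q \<alpha> = - (\<alpha> \<bullet> Q \<beta>)"
    using bivec_map_antisym(2)[OF \<Lambda> p, of \<beta> "snd (X p) c" \<alpha>]
      bivec_map_antisym(1)[OF \<Lambda> p, of \<beta> "adjoint A \<alpha>"] bivec_map_antisym(1)[OF \<Lambda> p, of \<alpha> "adjoint A \<beta>"]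
      adjoint_works[OF A, of "bivec_map \<Lambda> p \<beta>" \<alpha>] adjoint_works[OF A, of "bivec_map \<Lambda> p \<alpha>" \<beta>]
    by (simp add: Q_def inner_diff_right inner_commute)
  have "lie_derivative P X \<Lambda> p (coord_covec P c p \<alpha>) (coord_covec P c p \<beta>)
      = 1 / 2 * (\<Sum>i\<in>Basis. \<Sum>j\<in>Basis. (i \<bullet> Q j) * ((\<alpha> \<bullet> i) * (\<beta> \<bullet> j) - (\<beta> \<bullet> i) * (\<alpha> \<bullet> j)))"
    unfolding lie_derivative_def Let_def wedge_def c_def[symmetric] coord_covec_coord_vec[OF c]
    using lie_coeff_eq[OF X p, folded c_def, folded A_def, where \<Lambda> = \<Lambda>]
    by (simp add: Q_def inner_commute mult.commute)
  also have "\<dots> = 1 / 2 * (\<alpha> \<bullet> Q \<beta> - \<beta> \<bullet> Q \<alpha>)"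
    by (simp only: right_diff_distrib sum_subtractf sum_Basis_bilinear[OF \<open>linear Q\<close>])
  finally show ?thesis using anti by (simp add: Q_def)
qed

lemma lie_derivative_eq_0_iff:
  assumes \<Lambda>: "bivector_field P \<Lambda>" and X: "vector_field P X" and p: "p \<in> points P"
  defines "c \<equiv> chart_at P p"
  defines "A \<equiv> frechet_derivative (local_rep X c) (at (snd c p))"
  shows "(\<forall>a\<in>cotangent_space P p. \<forall>b\<in>cotangent_space P p. lie_derivative P X \<Lambda> p a b = 0)
    \<longleftrightarrow> (\<forall>\<beta>. bivec_deriv \<Lambda> p (snd (X p) c) \<beta> = A (bivec_map \<Lambda> p \<beta>) + bivec_map \<Lambda> p (adjoint A \<beta>))"
proof -
  have c: "c \<in> charts_at P p" unfolding c_def by (rule chart_at_charts_at[OF p])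
  have "(\<forall>\<alpha>. \<alpha> \<bullet> (l - m - n) = 0) \<longleftrightarrow> l = m + n" for l m n :: 'e
  proof
    assume "\<forall>\<alpha>. \<alpha> \<bullet> (l - m - n) = 0"
    then have "l - m - n = 0" using inner_eq_zero_iff by blast
    then show "l = m + n" by (simp add: algebra_simps)
  qed simp
  then show ?thesis
    unfolding cotangent_space_eq[OF c]
    using lie_derivative_coord_covec[OF \<Lambda> X p, folded c_def, folded A_def] by (simp, blast)
qed

text \<open>Charts turn the Lagrangian condition at a point into the one for the graph of \<open>A\<close>: the sharp map
  becomes \<open>F\<close>, and \<open>V\<close>, which passes from coordinates to tangent vectors, is injective and so
  reflects the equality of the two sets.\<close>

lemma lagrangian_at_iff:
  assumes \<Lambda>: "bivector_field P \<Lambda>" and X: "vector_field P X" and p: "p \<in> points P"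
  defines "c \<equiv> chart_at P p"
  defines "A \<equiv> frechet_derivative (local_rep X c) (at (snd c p))"
    and "sh \<equiv> sharp (tangent_bundle P) (tangent_lift P \<Lambda>) (X p)"
  shows "sh ` annihilator (tangent_bundle P) (X ` points P) (X p)
      = sh ` cotangent_space (tangent_bundle P) (X p)
        \<inter> tangent_subspace (tangent_bundle P) (X ` points P) (X p)
    \<longleftrightarrow> (\<forall>\<beta>. bivec_deriv \<Lambda> p (snd (X p) c) \<beta> = A (bivec_map \<Lambda> p \<beta>) + bivec_map \<Lambda> p (adjoint A \<beta>))"
proof -
  have c: "c \<in> charts_at P p" unfolding c_def by (rule chart_at_charts_at[OF p])
  note c' = charts_atD[OF c]
  have "(local_rep X c has_derivative A) (at (snd c p))"
    unfolding A_def using smooth_onD[OF smooth_local_rep[OF X c'(1)]] c'(2) by blast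
  then have A: "linear A" by (rule has_derivative_linear)
  let ?C = "tangent_chart P c"
  note C = tangent_chart_at[OF X c]
  define V where "V = coord_vec (tangent_bundle P) ?C (X p)"
  define F where "F = (\<lambda>(a, b). (- bivec_map \<Lambda> p b, - bivec_map \<Lambda> p a - bivec_deriv \<Lambda> p (snd (X p) c) b))"
  define T where "T = range (\<lambda>x. (x, A x))"
  have "inj V" unfolding V_def using TP.coord_vec_self[OF C] by (metis injI)
  have TN: "tangent_subspace (tangent_bundle P) (X ` points P) (X p) = V ` T"
    unfolding V_def T_def A_def by (rule tangent_subspace_vector_field[OF X c])
  have sh: "sh (coord_covec (tangent_bundle P) ?C (X p) z) = V (F z)" for z
    unfolding sh_def V_def
  proof (rule TP.sharp_coord_covec[OF C])
    fix \<beta>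
    have "tangent_lift P \<Lambda> (p, snd (X p)) (coord_covec (tangent_bundle P) ?C (p, snd (X p)) z)
        (coord_covec (tangent_bundle P) ?C (p, snd (X p)) \<beta>) = F z \<bullet> \<beta>"
      using tangent_lift_coord_covec[OF \<Lambda> p vector_fieldD(3)[OF X p], folded c_def, of "fst z" "snd z" \<beta>]
      by (simp add: F_def split_beta)
    then show "tangent_lift P \<Lambda> (X p) (coord_covec (tangent_bundle P) ?C (X p) z)
        (coord_covec (tangent_bundle P) ?C (X p) \<beta>) = F z \<bullet> \<beta>"
      using vector_fieldD(2)[OF X p] by simp
  qed
  have "annihilator (tangent_bundle P) (X ` points P) (X p)
      = coord_covec (tangent_bundle P) ?C (X p) ` {z. \<forall>t\<in>T. t \<bullet> z = 0}"
    unfolding annihilator_def TN TP.cotangent_space_eq[OF C] V_def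
    by (auto simp: TP.coord_covec_coord_vec[OF C])
  then have 1: "sh ` annihilator (tangent_bundle P) (X ` points P) (X p) = V ` F ` {z. \<forall>t\<in>T. t \<bullet> z = 0}"
    by (simp add: image_image sh)
  have "sh ` cotangent_space (tangent_bundle P) (X p) = V ` range F"
    unfolding TP.cotangent_space_eq[OF C] by (simp add: image_image sh)
  then have 2: "sh ` cotangent_space (tangent_bundle P) (X p) \<inter> V ` T = V ` (range F \<inter> T)"
    using image_Int[OF \<open>inj V\<close>] by simp
  show ?thesis
    unfolding 1 TN 2 inj_image_eq_iff[OF \<open>inj V\<close>] unfolding F_def T_def
    by (rule lagrangian_graph_iff[OF A]) (simp add: bivec_map_def linear_coeff_map)
qed

end

section \<open>Canonical vector fields\<close>

lemma smooth_structure_smooth_manifold: "smooth_manifold M \<Longrightarrow> smooth_structure M"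
  by (simp add: smooth_manifold_def smooth_structure_def)

theorem theorem6p2:
  fixes M :: "('a, 'e::euclidean_space) manifold"
    and \<Lambda> :: "'a \<Rightarrow> ('a, 'e) bivec"
    and X :: "'a \<Rightarrow> 'a \<times> ('a, 'e) tvec"
  assumes "poisson_manifold M \<Lambda>"
    and "vector_field M X"
  shows "canonical M \<Lambda> X \<longleftrightarrow>
    lagrangian_submanifold (tangent_bundle M) (tangent_lift M \<Lambda>) (X ` points M)"
proof -
  have \<Lambda>: "bivector_field M \<Lambda>" and "smooth_manifold M"
    using assms(1) by (auto simp: poisson_manifold_def)
  then interpret smooth_structure M by (intro smooth_structure_smooth_manifold)
  show ?thesis
    using vector_field_submanifold[OF assms(2)] lie_derivative_eq_0_iff[OF \<Lambda> assms(2)]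
      lagrangian_at_iff[OF \<Lambda> assms(2)]
    by (simp add: canonical_def lagrangian_submanifold_def)
qed

end
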